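(* Let $\mathbf{Pos}$ be the category of posets and monotone maps and let $\mathbf{AlexLoc}$ be the category of Alexandrov locales and complete maps between them. Let $B_{\mathbf{Pos}}:\mathbf{Pos}\to\mathbf{AlexLoc}$ be the functor sending a poset $\mathcal{P}$ to the locale whose frame is the set of upper sets of $\mathcal{P}$ ordered by inclusion, and a monotone map $f:\mathcal{P}\to\mathcal{Q}$ to the locale morphism whose frame homomorphism sends an upper set $S$ of $\mathcal{Q}$ to $f^{-1}(S)$. Let $I_B:\mathbf{AlexLoc}\to\mathbf{Pos}$ be the functor sending an Alexandrov locale $L$ to the opposite of the poset of supercompact elements of $\mathcal{O}(L)$, and a complete map $g:L\to L'$ to the opposite of the restriction, to the posets of supercompact elements, of the left adjoint $g_!:\mathcal{O}(L)\to\mathcal{O}(L')$ of $g^{\ast}:\mathcal{O}(L')\to\mathcal{O}(L)$. Then, via the functors $B_{\mathbf{Pos}}$ and $I_B$, the category $\mathbf{Pos}$ is equivalent to the category $\mathbf{AlexLoc}$.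
   Context: For a locale $L$, $\mathcal{O}(L)$ denotes its frame, and for a locale morphism $g:L\to L'$, $g^{\ast}:\mathcal{O}(L')\to\mathcal{O}(L)$ denotes the corresponding frame homomorphism. An element $a$ of a frame is supercompact if whenever $a=\bigvee_{i\in I}a_i$ (with $I$ any set, possibly empty) there is $i\in I$ with $a=a_i$. An Alexandrov locale is a locale isomorphic to the locale of upper sets of some preorder (equivalently, a locale with a basis of supercompact elements, i.e. such that every element is a join of supercompact elements). A complete map $g:L\to L'$ of Alexandrov locales is a locale morphism such that $g^{\ast}$ has a left adjoint $g_!$ (equivalently $g^{\ast}$ preserves arbitrary infima) which sends supercompact elements to supercompact elements. *)

theory Defs
  imports "HOL-Algebra.Galois_Connection" "HOL-Library.FuncSet"
begin

section \<open>Categories, functors and equivalences\<close>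

text \<open>
  \<open>Cmp C X Y Z g f\<close> is the composite of \<open>f : X \<rightarrow> Y\<close> followed by \<open>g : Y \<rightarrow> Z\<close>. It depends on the
  objects because hom-sets are not required to be disjoint.
\<close>

record ('o, 'm) category_data =
  Obj :: "'o set"
  Hom :: "'o \<Rightarrow> 'o \<Rightarrow> 'm set"
  Idn :: "'o \<Rightarrow> 'm"
  Cmp :: "'o \<Rightarrow> 'o \<Rightarrow> 'o \<Rightarrow> 'm \<Rightarrow> 'm \<Rightarrow> 'm"

locale category =
  fixes C :: "('o, 'm) category_data"
  assumes Idn_in_Hom: "X \<in> Obj C \<Longrightarrow> Idn C X \<in> Hom C X X"
    and Cmp_in_Hom: "\<lbrakk>X \<in> Obj C; Y \<in> Obj C; Z \<in> Obj C; f \<in> Hom C X Y; g \<in> Hom C Y Z\<rbrakk>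
      \<Longrightarrow> Cmp C X Y Z g f \<in> Hom C X Z"
    and Cmp_Idn_right: "\<lbrakk>X \<in> Obj C; Y \<in> Obj C; f \<in> Hom C X Y\<rbrakk>
      \<Longrightarrow> Cmp C X X Y f (Idn C X) = f"
    and Cmp_Idn_left: "\<lbrakk>X \<in> Obj C; Y \<in> Obj C; f \<in> Hom C X Y\<rbrakk>
      \<Longrightarrow> Cmp C X Y Y (Idn C Y) f = f"
    and Cmp_assoc: "\<lbrakk>W \<in> Obj C; X \<in> Obj C; Y \<in> Obj C; Z \<in> Obj C;
        f \<in> Hom C W X; g \<in> Hom C X Y; h \<in> Hom C Y Z\<rbrakk>
      \<Longrightarrow> Cmp C W X Z (Cmp C X Y Z h g) f = Cmp C W Y Z h (Cmp C W X Y g f)"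

definition iso_arrow :: "('o, 'm) category_data \<Rightarrow> 'o \<Rightarrow> 'o \<Rightarrow> 'm \<Rightarrow> bool" where
  "iso_arrow C X Y f \<longleftrightarrow> f \<in> Hom C X Y \<and>
     (\<exists>g\<in>Hom C Y X. Cmp C X Y X g f = Idn C X \<and> Cmp C Y X Y f g = Idn C Y)"

text \<open>\<open>FArr F X Y f\<close> is the image of \<open>f : X \<rightarrow> Y\<close>.\<close>

record ('o, 'm, 'p, 'n) functor_data =
  FObj :: "'o \<Rightarrow> 'p"
  FArr :: "'o \<Rightarrow> 'o \<Rightarrow> 'm \<Rightarrow> 'n"

locale cat_functor = dom: category C + cod: category D
  for C :: "('o, 'm) category_data" and D :: "('p, 'n) category_data" +
  fixes F :: "('o, 'm, 'p, 'n) functor_data"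
  assumes FObj_in_Obj: "X \<in> Obj C \<Longrightarrow> FObj F X \<in> Obj D"
    and FArr_in_Hom: "\<lbrakk>X \<in> Obj C; Y \<in> Obj C; f \<in> Hom C X Y\<rbrakk>
      \<Longrightarrow> FArr F X Y f \<in> Hom D (FObj F X) (FObj F Y)"
    and FArr_Idn: "X \<in> Obj C \<Longrightarrow> FArr F X X (Idn C X) = Idn D (FObj F X)"
    and FArr_Cmp: "\<lbrakk>X \<in> Obj C; Y \<in> Obj C; Z \<in> Obj C; f \<in> Hom C X Y; g \<in> Hom C Y Z\<rbrakk>
      \<Longrightarrow> FArr F X Z (Cmp C X Y Z g f)
          = Cmp D (FObj F X) (FObj F Y) (FObj F Z) (FArr F Y Z g) (FArr F X Y f)"

definition id_functor :: "('o, 'm, 'o, 'm) functor_data" where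
  "id_functor = \<lparr>FObj = (\<lambda>X. X), FArr = (\<lambda>X Y f. f)\<rparr>"

definition comp_functor ::
  "('p, 'n, 'q, 'k) functor_data \<Rightarrow> ('o, 'm, 'p, 'n) functor_data \<Rightarrow> ('o, 'm, 'q, 'k) functor_data" where
  "comp_functor G F =
     \<lparr>FObj = (\<lambda>X. FObj G (FObj F X)),
      FArr = (\<lambda>X Y f. FArr G (FObj F X) (FObj F Y) (FArr F X Y f))\<rparr>"

locale natural_iso = source: cat_functor C D F + target: cat_functor C D G
  for C :: "('o, 'm) category_data" and D :: "('p, 'n) category_data"
    and F G :: "('o, 'm, 'p, 'n) functor_data" +
  fixes \<eta> :: "'o \<Rightarrow> 'n"
  assumes component_iso: "X \<in> Obj C \<Longrightarrow> iso_arrow D (FObj F X) (FObj G X) (\<eta> X)"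
    and naturality: "\<lbrakk>X \<in> Obj C; Y \<in> Obj C; f \<in> Hom C X Y\<rbrakk>
      \<Longrightarrow> Cmp D (FObj F X) (FObj F Y) (FObj G Y) (\<eta> Y) (FArr F X Y f)
          = Cmp D (FObj F X) (FObj G X) (FObj G Y) (FArr G X Y f) (\<eta> X)"

definition equivalence_via ::
  "('o, 'm) category_data \<Rightarrow> ('p, 'n) category_data
   \<Rightarrow> ('o, 'm, 'p, 'n) functor_data \<Rightarrow> ('p, 'n, 'o, 'm) functor_data \<Rightarrow> bool" where
  "equivalence_via C D F G \<longleftrightarrow>
     cat_functor C D F \<and> cat_functor D C G \<and>
     (\<exists>\<eta>. natural_iso C C id_functor (comp_functor G F) \<eta>) \<and>
     (\<exists>\<epsilon>. natural_iso D D (comp_functor F G) id_functor \<epsilon>)"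

section \<open>Size\<close>

text \<open>
  HOL has no type of all sets, so the objects of the categories below live on subsets of a type
  \<open>'u\<close> of ``all sets'', of which some subsets are small, i.e.\ are themselves named by an
  element of \<open>'u\<close>. In a model \<open>'u\<close> of set theory, \<open>small A\<close> says that the class \<open>A\<close> is a set and
  \<open>code A\<close> is that set. Only the following three properties of such a universe are
  required. They do not force small sets to be closed under power sets, and
  \<open>universe_exists\<close> shows that for every infinite type \<open>'a\<close> the type \<open>'a set\<close> is such a universe,
  the small sets being those of at most the cardinality of \<open>'a\<close>.
\<close>

locale universe =
  fixes small :: "'u set \<Rightarrow> bool" and code :: "'u set \<Rightarrow> 'u"
  assumes small_subset: "small A \<Longrightarrow> B \<subseteq> A \<Longrightarrow> small B"
    and small_image: "small A \<Longrightarrow> small (f ` A)"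
    and code_inj: "inj_on code (Collect small)"

lemma universe_exists:
  assumes inf: "infinite (UNIV :: 'a set)"
  defines "small \<equiv> \<lambda>A :: 'a set set. \<exists>f :: 'a \<Rightarrow> 'a set. A \<subseteq> range f"
  shows "\<exists>code. universe small code"
proof -
  have "(card_of ((UNIV :: 'a set) \<times> (UNIV :: 'a set)), card_of (UNIV :: 'a set)) \<in> ordIso"
    using inf by (rule card_of_Times_same_infinite)
  then obtain p :: "'a \<times> 'a \<Rightarrow> 'a" where p: "inj p"
    by (metis UNIV_Times_UNIV bij_betw_def card_of_ordIso)
  obtain c d :: 'a where cd: "c \<noteq> d"
    using ex_new_if_finite[OF inf, of "{undefined}"] by auto
  define fam :: "'a set set \<Rightarrow> 'a \<Rightarrow> 'a set" where "fam A = (SOME f. range f = A)" for A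
  have fam: "range (fam A) = A" if A: "small A" "A \<noteq> {}" for A
  proof -
    obtain f :: "'a \<Rightarrow> 'a set" where f: "A \<subseteq> range f"
      using A unfolding small_def by blast
    obtain a where a: "a \<in> A" using A by blast
    have "range (\<lambda>x. if f x \<in> A then f x else a) = A" using f a by auto
    then show ?thesis
      unfolding fam_def by (rule someI[where P = "\<lambda>f. range f = A"])
  qed
  define code where "code A = (if A = {} then {} else
    insert (p (d, d)) {p (c, p (x, y)) |x y. y \<in> fam A x})" for A
  have dec: "fam A x = {y. p (c, p (x, y)) \<in> code A}" if "A \<noteq> {}" for A x
    using that cd by (auto simp: code_def inj_eq[OF p])
  have "inj_on code (Collect small)"
  proof (rule inj_onI, unfold mem_Collect_eq)
    fix A B assume AB: "small A" "small B" "code A = code B"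
    show "A = B"
    proof (cases "A = {} \<or> B = {}")
      case True
      then show ?thesis using AB(3) by (auto simp: code_def split: if_splits)
    next
      case False
      then have "fam A x = fam B x" for x using dec[of A x] dec[of B x] AB(3) by simp
      then have "range (fam A) = range (fam B)" by simp
      then show ?thesis using fam[of A] fam[of B] AB False by simp
    qed
  qed
  moreover have "small (g ` A)" if A: "small A" for g A
  proof -
    obtain f :: "'a \<Rightarrow> 'a set" where "A \<subseteq> range f" using A unfolding small_def by (elim exE)
    then have "g ` A \<subseteq> range (g \<circ> f)" unfolding image_comp[symmetric] by (rule image_mono)
    then show ?thesis unfolding small_def by (rule exI[where x = "g \<circ> f"])
  qed
  moreover have "small B" if A: "small A" and B: "B \<subseteq> A" for A B
  proof -
    obtain f :: "'a \<Rightarrow> 'a set" where "A \<subseteq> range f" using A unfolding small_def by (elim exE)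
    with B have "B \<subseteq> range f" by (rule subset_trans)
    then show ?thesis unfolding small_def by (rule exI[where x = f])
  qed
  ultimately have "universe small code" by (rule_tac universe.intro)
  then show ?thesis by (rule exI[where x = code])
qed

section \<open>Frames and locales\<close>

text \<open>
  A locale is represented by its frame, and a locale morphism \<open>g : L \<rightarrow> L'\<close> by the frame
  homomorphism \<open>g\<^sup>*\<close> from the frame of \<open>L'\<close> to the frame of \<open>L\<close>.
\<close>

locale frame = complete_lattice +
  assumes meet_sup_distrib:
    "\<lbrakk>x \<in> carrier L; A \<subseteq> carrier L\<rbrakk> \<Longrightarrow> x \<sqinter> (\<Squnion> A) = \<Squnion> ((\<lambda>a. x \<sqinter> a) ` A)"

definition frame_hom :: "'a gorder \<Rightarrow> 'b gorder \<Rightarrow> ('a \<Rightarrow> 'b) \<Rightarrow> bool" where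
  "frame_hom L M f \<longleftrightarrow> frame L \<and> frame M \<and> f \<in> carrier L \<rightarrow> carrier M \<and>
     sup_pres L M f \<and> meet_pres L M f \<and> f \<top>\<^bsub>L\<^esub> = \<top>\<^bsub>M\<^esub>"

definition isomorphic_locales :: "'a gorder \<Rightarrow> 'b gorder \<Rightarrow> bool" where
  "isomorphic_locales L M \<longleftrightarrow>
     (\<exists>f g. frame_hom L M f \<and> frame_hom M L g \<and>
        (\<forall>x\<in>carrier L. g (f x) = x) \<and> (\<forall>y\<in>carrier M. f (g y) = y))"

text \<open>A family of elements is replaced by the set of its members, which is possibly empty.\<close>

definition supercompact :: "'a gorder \<Rightarrow> 'a \<Rightarrow> bool" where
  "supercompact L a \<longleftrightarrow> a \<in> carrier L \<and> (\<forall>A. A \<subseteq> carrier L \<and> a = \<Squnion>\<^bsub>L\<^esub> A \<longrightarrow> a \<in> A)"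

definition upper_sets :: "'a set \<Rightarrow> ('a \<Rightarrow> 'a \<Rightarrow> bool) \<Rightarrow> 'a set set" where
  "upper_sets A r = {S. S \<subseteq> A \<and> (\<forall>x\<in>S. \<forall>y\<in>A. r x y \<longrightarrow> y \<in> S)}"

definition upper_set_frame :: "'a set \<Rightarrow> ('a \<Rightarrow> 'a \<Rightarrow> bool) \<Rightarrow> 'a set gorder" where
  "upper_set_frame A r = \<lparr>carrier = upper_sets A r, eq = (=), le = (\<subseteq>)\<rparr>"

text \<open>
  The preorder is required to be small; the carrier of \<open>L\<close> is then the size of a power set of a
  small set, which in a model of set theory is small as well.
\<close>

definition alexandrov_locale :: "('u set \<Rightarrow> bool) \<Rightarrow> 'u gorder \<Rightarrow> bool" where
  "alexandrov_locale small L \<longleftrightarrow> frame L \<and>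
     (\<exists>(A :: 'u set) r. small A \<and> reflp_on A r \<and> transp_on A r \<and>
        isomorphic_locales L (upper_set_frame A r))"

definition is_left_adjoint :: "'a gorder \<Rightarrow> 'b gorder \<Rightarrow> ('b \<Rightarrow> 'a) \<Rightarrow> ('a \<Rightarrow> 'b) \<Rightarrow> bool" where
  "is_left_adjoint L L' g l \<longleftrightarrow>
     galois_connection \<lparr>orderA = L, orderB = L', lower = l, upper = g\<rparr>"

definition left_adjoint :: "'a gorder \<Rightarrow> 'b gorder \<Rightarrow> ('b \<Rightarrow> 'a) \<Rightarrow> 'a \<Rightarrow> 'b" where
  "left_adjoint L L' g = (THE l. l \<in> extensional (carrier L) \<and> is_left_adjoint L L' g l)"

text \<open>The third argument of \<open>complete_map L L'\<close> is \<open>g\<^sup>*\<close>, for \<open>g : L \<rightarrow> L'\<close>.\<close>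

definition complete_map :: "'a gorder \<Rightarrow> 'b gorder \<Rightarrow> ('b \<Rightarrow> 'a) \<Rightarrow> bool" where
  "complete_map L L' g \<longleftrightarrow> frame_hom L' L g \<and>
     (\<exists>l. is_left_adjoint L L' g l \<and> (\<forall>a. supercompact L a \<longrightarrow> supercompact L' (l a)))"

section \<open>The two categories and the two functors\<close>

text \<open>
  The order of a \<open>gorder\<close> record is arbitrary outside its carrier. Requiring it to be false there
  makes the record determined by the poset it represents.
\<close>

definition order_on_carrier :: "'a gorder \<Rightarrow> bool" where
  "order_on_carrier L \<longleftrightarrow> (\<forall>x y. x \<sqsubseteq>\<^bsub>L\<^esub> y \<longrightarrow> x \<in> carrier L \<and> y \<in> carrier L)"

definition Pos :: "('u set \<Rightarrow> bool) \<Rightarrow> ('u gorder, 'u \<Rightarrow> 'u) category_data" where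
  "Pos small =
     \<lparr>Obj = {P. partial_order P \<and> order_on_carrier P \<and> small (carrier P)},
      Hom = (\<lambda>P Q. {f \<in> carrier P \<rightarrow>\<^sub>E carrier Q. isotone P Q f}),
      Idn = (\<lambda>P. \<lambda>x\<in>carrier P. x),
      Cmp = (\<lambda>P Q R g f. compose (carrier P) g f)\<rparr>"

text \<open>\<open>(h \<circ> g)\<^sup>* = g\<^sup>* \<circ> h\<^sup>*\<close>\<close>

definition AlexLoc :: "('u set \<Rightarrow> bool) \<Rightarrow> ('u gorder, 'u \<Rightarrow> 'u) category_data" where
  "AlexLoc small =
     \<lparr>Obj = {L. alexandrov_locale small L \<and> order_on_carrier L},
      Hom = (\<lambda>L L'. {g \<in> carrier L' \<rightarrow>\<^sub>E carrier L. complete_map L L' g}),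
      Idn = (\<lambda>L. \<lambda>x\<in>carrier L. x),
      Cmp = (\<lambda>L L' L'' h g. compose (carrier L'') g h)\<rparr>"

text \<open>The frame of upper sets of \<open>P\<close>, with each upper set \<open>S\<close> named by \<open>code S\<close>.\<close>

definition B_Pos_obj :: "('u set \<Rightarrow> 'u) \<Rightarrow> 'u gorder \<Rightarrow> 'u gorder" where
  "B_Pos_obj code P =
     (let U = upper_sets (carrier P) (le P) in
      \<lparr>carrier = code ` U, eq = (=),
       le = (\<lambda>u v. \<exists>S\<in>U. \<exists>T\<in>U. u = code S \<and> v = code T \<and> S \<subseteq> T)\<rparr>)"

definition B_Pos_arr ::
  "('u set \<Rightarrow> 'u) \<Rightarrow> 'u gorder \<Rightarrow> 'u gorder \<Rightarrow> ('u \<Rightarrow> 'u) \<Rightarrow> ('u \<Rightarrow> 'u)" where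
  "B_Pos_arr code P Q f =
     (\<lambda>u\<in>carrier (B_Pos_obj code Q).
        code (f -` inv_into (upper_sets (carrier Q) (le Q)) code u \<inter> carrier P))"

definition B_Pos ::
  "('u set \<Rightarrow> 'u) \<Rightarrow> ('u gorder, 'u \<Rightarrow> 'u, 'u gorder, 'u \<Rightarrow> 'u) functor_data" where
  "B_Pos code = \<lparr>FObj = B_Pos_obj code, FArr = B_Pos_arr code\<rparr>"

definition supercompact_poset :: "'a gorder \<Rightarrow> 'a gorder" where
  "supercompact_poset L =
     \<lparr>carrier = Collect (supercompact L), eq = (=),
      le = (\<lambda>x y. supercompact L x \<and> supercompact L y \<and> x \<sqsubseteq>\<^bsub>L\<^esub> y)\<rparr>"

text \<open>The opposite of a monotone map has the same underlying function.\<close>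

definition I_B :: "('u gorder, 'u \<Rightarrow> 'u, 'u gorder, 'u \<Rightarrow> 'u) functor_data" where
  "I_B =
     \<lparr>FObj = (\<lambda>L. inv_gorder (supercompact_poset L)),
      FArr = (\<lambda>L L' g. restrict (left_adjoint L L' g) (Collect (supercompact L)))\<rparr>"

end

theory Submission
  imports Defs
begin

text \<open>
  An Alexandrov locale is determined by its supercompact elements. Two facts make this work. By
  the distributive law of a frame, a supercompact element \<open>s\<close> is completely join-prime: if it lies
  below a join, it lies below one of the joined elements (\<open>supercompact_le_sup_iff\<close>). And in the
  frame of upper sets of a preorder the supercompact elements are exactly the principal upper
  sets, so that every element is determined by the supercompact elements below it
  (\<open>supercompact_upper_set_frame_iff\<close>, \<open>supercompactly_generated_alexandrov\<close>).

  Consequently \<open>a \<mapsto> {s. s supercompact, s \<le> a}\<close> is an order isomorphism from an Alexandrov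
  frame to the lower sets of its poset of supercompact elements, that is, to the upper sets of the
  opposite poset; its inverse takes joins. This is the counit. In the other direction, a
  poset \<open>P\<close> is isomorphic, by \<open>x \<mapsto> \<up>x\<close>, to the opposite of the poset of supercompact elements of its
  frame of upper sets, since \<open>\<up>y \<subseteq> \<up>x\<close> means \<open>x \<le> y\<close>. This is the unit.

  Arrows are handled through adjoints. The left adjoint of \<open>f\<^sup>-\<^sup>1\<close> sends an upper set to the upper
  closure of its image, hence \<open>\<up>x\<close> to \<open>\<up>(f x)\<close>; this is the naturality of the unit. For a complete
  map \<open>g\<close> and a supercompact element \<open>s\<close>, \<open>g\<^sub>! s \<le> a\<close> holds iff \<open>s \<le> g\<^sup>* a\<close>; this is the naturality
  of the counit. Functoriality reduces to the composition of adjoints, because between frames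
  that are generated by supercompact elements a map whose left adjoint preserves supercompact
  elements is automatically a frame homomorphism (\<open>complete_mapI\<close>).
\<close>

section \<open>Transport along order isomorphisms\<close>

lemma (in partial_order) sup_eqI: "least L s (Upper L A) \<Longrightarrow> \<Squnion>A = s"
  unfolding sup_def by (rule some_equality) (auto intro: least_unique)

lemma (in partial_order) inf_eqI: "greatest L s (Lower L A) \<Longrightarrow> \<Sqinter>A = s"
  unfolding inf_def by (rule some_equality) (auto intro: greatest_unique)

lemma (in complete_lattice) inf_empty: "\<Sqinter>{} = \<top>"
  using weak_inf_empty by (simp add: eq_is_equal)

lemma gorder_partial_orderI:
  fixes L :: "'a gorder"
  assumes "eq L = (=)"
    and "\<And>x. x \<in> carrier L \<Longrightarrow> x \<sqsubseteq>\<^bsub>L\<^esub> x"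
    and "\<And>x y. x \<in> carrier L \<Longrightarrow> y \<in> carrier L \<Longrightarrow> x \<sqsubseteq>\<^bsub>L\<^esub> y \<Longrightarrow> y \<sqsubseteq>\<^bsub>L\<^esub> x \<Longrightarrow> x = y"
    and "\<And>x y z. x \<in> carrier L \<Longrightarrow> y \<in> carrier L \<Longrightarrow> z \<in> carrier L \<Longrightarrow>
      x \<sqsubseteq>\<^bsub>L\<^esub> y \<Longrightarrow> y \<sqsubseteq>\<^bsub>L\<^esub> z \<Longrightarrow> x \<sqsubseteq>\<^bsub>L\<^esub> z"
  shows "partial_order L"
  by unfold_locales (simp_all add: assms(1,2), (blast intro: assms(3,4))+)

text \<open>
  The inverse is a parameter so that the situation is symmetric: every result about \<open>f\<close> yields
  one about \<open>g\<close> (lemma \<open>inverse\<close>), and every result about joins one about meets (lemma \<open>dual\<close>).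
  Only the values of \<open>f\<close> and \<open>g\<close> on the carriers are constrained.
\<close>

locale order_isomorphism = L: partial_order L + M: partial_order M
  for L :: "'a gorder" and M :: "'b gorder" +
  fixes f :: "'a \<Rightarrow> 'b" and g :: "'b \<Rightarrow> 'a"
  assumes f_closed: "x \<in> carrier L \<Longrightarrow> f x \<in> carrier M"
    and g_closed: "y \<in> carrier M \<Longrightarrow> g y \<in> carrier L"
    and g_f: "x \<in> carrier L \<Longrightarrow> g (f x) = x"
    and f_g: "y \<in> carrier M \<Longrightarrow> f (g y) = y"
    and f_le_iff: "x \<in> carrier L \<Longrightarrow> x' \<in> carrier L \<Longrightarrow> f x \<sqsubseteq>\<^bsub>M\<^esub> f x' \<longleftrightarrow> x \<sqsubseteq>\<^bsub>L\<^esub> x'"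
begin

lemma inverse: "order_isomorphism M L g f"
proof unfold_locales
  show "g y \<sqsubseteq>\<^bsub>L\<^esub> g y' \<longleftrightarrow> y \<sqsubseteq>\<^bsub>M\<^esub> y'" if "y \<in> carrier M" "y' \<in> carrier M" for y y'
    using f_le_iff[of "g y" "g y'"] that g_closed f_g by simp
qed (simp_all add: f_closed g_closed g_f f_g)

lemma dual: "order_isomorphism (inv_gorder L) (inv_gorder M) f g"
  by (rule order_isomorphism.intro[OF L.dual_order M.dual_order], unfold_locales)
    (simp_all add: f_closed g_closed g_f f_g f_le_iff)

lemma f_le_iff_le_g: "x \<in> carrier L \<Longrightarrow> y \<in> carrier M \<Longrightarrow> f x \<sqsubseteq>\<^bsub>M\<^esub> y \<longleftrightarrow> x \<sqsubseteq>\<^bsub>L\<^esub> g y"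
  using f_le_iff[OF _ g_closed, of x y] f_g[of y] by simp

lemma image_g_f: "A \<subseteq> carrier L \<Longrightarrow> g ` f ` A = A"
  by (simp add: image_image g_f subset_eq cong: image_cong)

lemma least_Upper_transport:
  assumes A: "A \<subseteq> carrier M" and s: "least L s (Upper L (g ` A))"
  shows "least M (f s) (Upper M A)"
proof (rule least_UpperI)
  have sL: "s \<in> carrier L" using s by simp
  have gA: "g ` A \<subseteq> carrier L" using A g_closed by auto
  show "f s \<in> carrier M" using sL f_closed by blast
  show "x \<sqsubseteq>\<^bsub>M\<^esub> f s" if x: "x \<in> A" for x
  proof -
    have "g x \<sqsubseteq>\<^bsub>L\<^esub> s" using least_Upper_above[OF s _ gA] x by blast
    then have "f (g x) \<sqsubseteq>\<^bsub>M\<^esub> f s" using x A sL g_closed by (subst f_le_iff) auto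
    then show ?thesis using x A f_g by auto
  qed
  show "f s \<sqsubseteq>\<^bsub>M\<^esub> y" if y: "y \<in> Upper M A" for y
  proof -
    have yM: "y \<in> carrier M" using y by (simp add: Upper_def)
    have "g x \<sqsubseteq>\<^bsub>L\<^esub> g y" if "x \<in> A" for x
      using that y yM A order_isomorphism.f_le_iff[OF inverse, of x y] by (auto simp: Upper_def)
    then have "g y \<in> Upper L (g ` A)" using yM g_closed by (auto simp: Upper_def)
    then have "s \<sqsubseteq>\<^bsub>L\<^esub> g y" by (rule least_le[OF s])
    then show ?thesis using f_le_iff_le_g sL yM by simp
  qed
qed (rule A)

lemma greatest_Lower_transport:
  "A \<subseteq> carrier M \<Longrightarrow> greatest L s (Lower L (g ` A)) \<Longrightarrow> greatest M (f s) (Lower M A)"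
  using order_isomorphism.least_Upper_transport[OF dual] by simp

lemma complete_lattice_transport:
  assumes "complete_lattice L"
  shows "complete_lattice M"
proof (rule M.complete_latticeI)
  interpret C: complete_lattice L by fact
  fix A assume A: "A \<subseteq> carrier M"
  then have gA: "g ` A \<subseteq> carrier L" using g_closed by auto
  show "\<exists>s. least M s (Upper M A)"
    using least_Upper_transport[OF A] C.sup_exists[OF gA] by blast
  show "\<exists>i. greatest M i (Lower M A)"
    using greatest_Lower_transport[OF A] C.inf_exists[OF gA] by blast
qed

lemma sup_transport:
  assumes "complete_lattice L" and A: "A \<subseteq> carrier L"
  shows "f (\<Squnion>\<^bsub>L\<^esub> A) = \<Squnion>\<^bsub>M\<^esub> (f ` A)"
proof -
  interpret C: complete_lattice L by fact
  have "f ` A \<subseteq> carrier M" using A f_closed by auto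
  then have "least M (f (\<Squnion>\<^bsub>L\<^esub> A)) (Upper M (f ` A))"
    using least_Upper_transport C.sup_lub[OF A] image_g_f[OF A] by simp
  then show ?thesis using M.sup_eqI by simp
qed

lemma inf_transport:
  assumes "complete_lattice L" and A: "A \<subseteq> carrier L"
  shows "f (\<Sqinter>\<^bsub>L\<^esub> A) = \<Sqinter>\<^bsub>M\<^esub> (f ` A)"
proof -
  interpret C: complete_lattice L by fact
  have "f ` A \<subseteq> carrier M" using A f_closed by auto
  then have "greatest M (f (\<Sqinter>\<^bsub>L\<^esub> A)) (Lower M (f ` A))"
    using greatest_Lower_transport C.inf_glb[OF A] image_g_f[OF A] by simp
  then show ?thesis using M.inf_eqI by simp
qed

lemma meet_transport:
  "complete_lattice L \<Longrightarrow> x \<in> carrier L \<Longrightarrow> y \<in> carrier L \<Longrightarrow>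
    f (x \<sqinter>\<^bsub>L\<^esub> y) = f x \<sqinter>\<^bsub>M\<^esub> f y"
  unfolding meet_def using inf_transport[of "{x, y}"] by simp

lemma frame_transport:
  assumes "frame L"
  shows "frame M"
proof -
  interpret F: frame L by fact
  have cM: "complete_lattice M"
    by (rule complete_lattice_transport) (rule F.complete_lattice_axioms)
  interpret M: complete_lattice M by (rule cM)
  note cL = F.complete_lattice_axioms
  show ?thesis
  proof unfold_locales
    fix x A assume x: "x \<in> carrier M" and A: "A \<subseteq> carrier M"
    have gA: "g ` A \<subseteq> carrier L" using A g_closed by auto
    have fgA: "f ` g ` A = A" using order_isomorphism.image_g_f[OF inverse] A by simp
    have "x \<sqinter>\<^bsub>M\<^esub> (\<Squnion>\<^bsub>M\<^esub> A) = f (g x) \<sqinter>\<^bsub>M\<^esub> f (\<Squnion>\<^bsub>L\<^esub> (g ` A))"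
      using sup_transport[OF cL gA] fgA x f_g by simp
    also have "\<dots> = f (g x \<sqinter>\<^bsub>L\<^esub> (\<Squnion>\<^bsub>L\<^esub> (g ` A)))"
      using meet_transport[OF cL] x g_closed gA by simp
    also have "\<dots> = f (\<Squnion>\<^bsub>L\<^esub> ((\<lambda>a. g x \<sqinter>\<^bsub>L\<^esub> a) ` g ` A))"
      using F.meet_sup_distrib[OF _ gA] x g_closed by simp
    also have "\<dots> = \<Squnion>\<^bsub>M\<^esub> (f ` (\<lambda>a. g x \<sqinter>\<^bsub>L\<^esub> a) ` g ` A)"
      by (rule sup_transport[OF cL]) (use x gA g_closed in auto)
    also have "f ` (\<lambda>a. g x \<sqinter>\<^bsub>L\<^esub> a) ` g ` A = (\<lambda>a. x \<sqinter>\<^bsub>M\<^esub> a) ` A"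
      unfolding image_image
      by (rule image_cong) (use x A g_closed f_g meet_transport[OF cL] in auto)
    finally show "x \<sqinter>\<^bsub>M\<^esub> (\<Squnion>\<^bsub>M\<^esub> A) = \<Squnion>\<^bsub>M\<^esub> ((\<lambda>a. x \<sqinter>\<^bsub>M\<^esub> a) ` A)" .
  qed
qed

lemma frame_hom:
  assumes "frame L"
  shows "frame_hom L M f"
proof -
  interpret F: frame L by fact
  have fM: "frame M" by (rule frame_transport) fact
  interpret M: frame M by (rule fM)
  note cL = F.complete_lattice_axioms
  have "f \<top>\<^bsub>L\<^esub> = \<top>\<^bsub>M\<^esub>"
    using inf_transport[OF cL, of "{}"] complete_lattice.inf_empty[OF cL]
      complete_lattice.inf_empty[OF M.complete_lattice_axioms] by simp
  then show ?thesis
    unfolding frame_hom_def sup_pres_def meet_pres_def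
    using assms fM cL M.complete_lattice_axioms sup_transport[OF cL] meet_transport[OF cL] f_closed
    by (auto intro: complete_lattice_lattice)
qed

lemma isomorphic_locales:
  assumes "frame L"
  shows "isomorphic_locales L M"
  unfolding isomorphic_locales_def
  using frame_hom[OF assms] order_isomorphism.frame_hom[OF inverse frame_transport[OF assms]]
    g_f f_g by blast

lemma supercompact_transport:
  assumes "complete_lattice L" and a: "supercompact L a"
  shows "supercompact M (f a)"
  unfolding supercompact_def
proof (intro conjI allI impI)
  have aL: "a \<in> carrier L" using a by (simp add: supercompact_def)
  then show "f a \<in> carrier M" by (rule f_closed)
  fix B assume B: "B \<subseteq> carrier M \<and> f a = \<Squnion>\<^bsub>M\<^esub> B"
  have "a = g (\<Squnion>\<^bsub>M\<^esub> B)" using B g_f[OF aL] by simp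
  also have "\<dots> = \<Squnion>\<^bsub>L\<^esub> (g ` B)"
    using order_isomorphism.sup_transport[OF inverse complete_lattice_transport] assms(1) B by blast
  finally have "a = \<Squnion>\<^bsub>L\<^esub> (g ` B)" .
  moreover have "g ` B \<subseteq> carrier L" using B g_closed by auto
  ultimately have "a \<in> g ` B" using a unfolding supercompact_def by blast
  then show "f a \<in> B" using B f_g by auto
qed

end

text \<open>
  The unit, the counit and the naming of upper sets are shown to be isomorphisms in this way: it is
  enough to know the map in one direction,
  and injectivity comes from antisymmetry.
\<close>

lemma order_isomorphism_of_surj_embedding:
  assumes "partial_order L" "partial_order M"
    and surj: "f ` carrier L = carrier M"
    and emb: "\<And>x x'. x \<in> carrier L \<Longrightarrow> x' \<in> carrier L \<Longrightarrow> f x \<sqsubseteq>\<^bsub>M\<^esub> f x' \<longleftrightarrow> x \<sqsubseteq>\<^bsub>L\<^esub> x'"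
  shows "order_isomorphism L M f (inv_into (carrier L) f)"
proof -
  interpret L: partial_order L by fact
  interpret M: partial_order M by fact
  have inj: "inj_on f (carrier L)"
  proof (rule inj_onI)
    fix x y assume xy: "x \<in> carrier L" "y \<in> carrier L" "f x = f y"
    then have "f x \<in> carrier M" using surj by blast
    then have "f x \<sqsubseteq>\<^bsub>M\<^esub> f y" "f y \<sqsubseteq>\<^bsub>M\<^esub> f x" using xy by simp_all
    then have "x \<sqsubseteq>\<^bsub>L\<^esub> y" "y \<sqsubseteq>\<^bsub>L\<^esub> x" using emb xy(1,2) by blast+
    then show "x = y" using xy by blast
  qed
  show ?thesis
  proof unfold_locales
    show "f x \<in> carrier M" if "x \<in> carrier L" for x using that surj by blast
    show "inv_into (carrier L) f y \<in> carrier L" "f (inv_into (carrier L) f y) = y"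
      if "y \<in> carrier M" for y
      using that surj by (auto intro: inv_into_into f_inv_into_f)
    show "inv_into (carrier L) f (f x) = x" if "x \<in> carrier L" for x
      using that inj by simp
  qed (rule emb)
qed

section \<open>Frames of upper sets\<close>

lemma upper_set_frame_simps [simp]:
  "carrier (upper_set_frame A r) = upper_sets A r"
  "le (upper_set_frame A r) = (\<subseteq>)"
  by (simp_all add: upper_set_frame_def)

lemma upper_sets_Union: "F \<subseteq> upper_sets A r \<Longrightarrow> \<Union>F \<in> upper_sets A r"
  by (auto simp: upper_sets_def) blast

text \<open>
  The intersection with \<open>A\<close> matters for the empty family, whose meet is \<open>A\<close> rather than \<open>UNIV\<close>.
\<close>

lemma upper_sets_Inter: "F \<subseteq> upper_sets A r \<Longrightarrow> A \<inter> \<Inter>F \<in> upper_sets A r"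
  by (auto simp: upper_sets_def)

lemma partial_order_upper_set_frame: "partial_order (upper_set_frame A r)"
  by (rule gorder_partial_orderI) (auto simp: upper_set_frame_def)

lemma sup_upper_set_frame:
  assumes "F \<subseteq> upper_sets A r"
  shows "least (upper_set_frame A r) (\<Union>F) (Upper (upper_set_frame A r) F)"
  by (rule least_UpperI) (use assms upper_sets_Union[OF assms] in \<open>auto simp: Upper_def\<close>)

lemma inf_upper_set_frame:
  assumes "F \<subseteq> upper_sets A r"
  shows "greatest (upper_set_frame A r) (A \<inter> \<Inter>F) (Lower (upper_set_frame A r) F)"
proof (rule greatest_LowerI)
  fix y assume y: "y \<in> Lower (upper_set_frame A r) F"
  then have "y \<subseteq> A" by (auto simp: Lower_def upper_sets_def)
  moreover have "y \<subseteq> X" if "X \<in> F" for X using y that assms by (auto simp: Lower_def)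
  ultimately show "y \<sqsubseteq>\<^bsub>upper_set_frame A r\<^esub> A \<inter> \<Inter>F" by auto
qed (use assms upper_sets_Inter[OF assms] in auto)

lemmas upper_set_frame_sup = partial_order.sup_eqI[OF partial_order_upper_set_frame sup_upper_set_frame]
lemmas upper_set_frame_inf = partial_order.inf_eqI[OF partial_order_upper_set_frame inf_upper_set_frame]

lemma frame_upper_set_frame: "frame (upper_set_frame A r)"
proof -
  interpret P: partial_order "upper_set_frame A r" by (rule partial_order_upper_set_frame)
  interpret complete_lattice "upper_set_frame A r"
    by (rule P.complete_latticeI)
      (use sup_upper_set_frame[where A = A and r = r] inf_upper_set_frame[where A = A and r = r]
        in auto)
  show ?thesis
  proof unfold_locales
    fix x F assume x: "x \<in> carrier (upper_set_frame A r)" and F: "F \<subseteq> carrier (upper_set_frame A r)"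
    have meet: "x \<sqinter>\<^bsub>upper_set_frame A r\<^esub> y = x \<inter> y" if "y \<in> upper_sets A r" for y
      using upper_set_frame_inf[of "{x, y}" A r] x that
      by (auto simp: meet_def upper_sets_def)
    have im: "(\<lambda>a. x \<sqinter>\<^bsub>upper_set_frame A r\<^esub> a) ` F = (\<lambda>a. x \<inter> a) ` F"
      by (rule image_cong) (use F meet in auto)
    have "(\<lambda>a. x \<inter> a) ` F \<subseteq> upper_sets A r"
      using x F by (auto simp: upper_sets_def)
    then show "x \<sqinter>\<^bsub>upper_set_frame A r\<^esub> (\<Squnion>\<^bsub>upper_set_frame A r\<^esub> F)
       = \<Squnion>\<^bsub>upper_set_frame A r\<^esub> ((\<lambda>a. x \<sqinter>\<^bsub>upper_set_frame A r\<^esub> a) ` F)"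
      using F upper_set_frame_sup[of F A r] upper_set_frame_sup[of "(\<lambda>a. x \<inter> a) ` F" A r]
        meet[OF upper_sets_Union] im by auto
  qed
qed

definition principal_upper_set :: "'a set \<Rightarrow> ('a \<Rightarrow> 'a \<Rightarrow> bool) \<Rightarrow> 'a \<Rightarrow> 'a set" where
  "principal_upper_set A r x = {y \<in> A. r x y}"

lemma principal_upper_set_in_upper_sets:
  "transp_on A r \<Longrightarrow> x \<in> A \<Longrightarrow> principal_upper_set A r x \<in> upper_sets A r"
  by (auto simp: principal_upper_set_def upper_sets_def dest: transp_onD)

lemma principal_upper_set_subset_iff:
  "reflp_on A r \<Longrightarrow> x \<in> A \<Longrightarrow> S \<in> upper_sets A r \<Longrightarrow> principal_upper_set A r x \<subseteq> S \<longleftrightarrow> x \<in> S"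
  by (auto simp: principal_upper_set_def upper_sets_def dest: reflp_onD)

text \<open>
  An upper set is the union of the principal upper sets of its elements, so a supercompact one is
  among them. Conversely, if \<open>\<up>x\<close> is a union of upper sets, one of them contains \<open>x\<close>, hence all
  of \<open>\<up>x\<close>.
\<close>

lemma supercompact_upper_set_frame_iff:
  assumes r: "reflp_on A r" "transp_on A r"
  shows "supercompact (upper_set_frame A r) S \<longleftrightarrow> (\<exists>x\<in>A. S = principal_upper_set A r x)"
proof
  assume S: "supercompact (upper_set_frame A r) S"
  then have SU: "S \<in> upper_sets A r" by (simp add: supercompact_def)
  let ?F = "principal_upper_set A r ` S"
  have SA: "S \<subseteq> A" using SU by (auto simp: upper_sets_def)
  have F: "?F \<subseteq> upper_sets A r" using SA principal_upper_set_in_upper_sets[OF r(2)] by auto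
  have "\<Union>?F = S"
  proof
    show "\<Union>?F \<subseteq> S" using principal_upper_set_subset_iff[OF r(1) _ SU] SA by auto
    show "S \<subseteq> \<Union>?F" using SA reflp_onD[OF r(1)] by (auto simp: principal_upper_set_def)
  qed
  then have "S = \<Squnion>\<^bsub>upper_set_frame A r\<^esub> ?F" using upper_set_frame_sup[OF F] by simp
  then have "S \<in> ?F" using S F unfolding supercompact_def by auto
  then show "\<exists>x\<in>A. S = principal_upper_set A r x" using SA by auto
next
  assume "\<exists>x\<in>A. S = principal_upper_set A r x"
  then obtain x where x: "x \<in> A" and S: "S = principal_upper_set A r x" by auto
  show "supercompact (upper_set_frame A r) S"
    unfolding supercompact_def
  proof (intro conjI allI impI)
    show "S \<in> carrier (upper_set_frame A r)"
      using S x principal_upper_set_in_upper_sets[OF r(2)] by simp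
    fix F assume F: "F \<subseteq> carrier (upper_set_frame A r) \<and> S = \<Squnion>\<^bsub>upper_set_frame A r\<^esub> F"
    then have SF: "S = \<Union>F" using upper_set_frame_sup[of F A r] by simp
    have "x \<in> S" using S x reflp_onD[OF r(1)] by (simp add: principal_upper_set_def)
    then obtain T where T: "T \<in> F" "x \<in> T" using SF by auto
    then have "S \<subseteq> T" using principal_upper_set_subset_iff[OF r(1) x, of T] S F by auto
    then have "S = T" using SF T(1) by auto
    then show "S \<in> F" using T(1) by simp
  qed
qed


section \<open>Supercompact elements of Alexandrov locales\<close>

lemma supercompact_closed: "supercompact L s \<Longrightarrow> s \<in> carrier L"
  by (simp add: supercompact_def)

text \<open>
  Supercompact elements are completely join-prime: if \<open>s \<le> \<Squnion>A\<close>, then distributivity gives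
  \<open>s = \<Squnion>{s \<sqinter> a | a \<in> A}\<close>, and supercompactness turns this into \<open>s = s \<sqinter> a\<close> for some \<open>a\<close>.
\<close>

lemma supercompact_le_sup_iff:
  fixes L :: "'a gorder" (structure)
  assumes "frame L" and s: "supercompact L s" and A: "A \<subseteq> carrier L"
  shows "s \<sqsubseteq> \<Squnion>A \<longleftrightarrow> (\<exists>a\<in>A. s \<sqsubseteq> a)"
proof
  interpret frame L by fact
  have sL: "s \<in> carrier L" using s by (rule supercompact_closed)
  assume "s \<sqsubseteq> \<Squnion>A"
  then have "s = s \<sqinter> \<Squnion>A" using sL A le_iff_join[of s "\<Squnion>A"] by simp
  also have "\<dots> = \<Squnion>((\<lambda>a. s \<sqinter> a) ` A)" using meet_sup_distrib sL A by simp
  finally have "s = \<Squnion>((\<lambda>a. s \<sqinter> a) ` A)" .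
  moreover have "(\<lambda>a. s \<sqinter> a) ` A \<subseteq> carrier L" using sL A by auto
  ultimately have "s \<in> (\<lambda>a. s \<sqinter> a) ` A" using s unfolding supercompact_def by blast
  then obtain a where a: "a \<in> A" "s = s \<sqinter> a" by auto
  then have "s \<sqsubseteq> a" using sL A le_iff_join[of s a] by auto
  then show "\<exists>a\<in>A. s \<sqsubseteq> a" using a by auto
next
  interpret frame L by fact
  have sL: "s \<in> carrier L" using s by (rule supercompact_closed)
  assume "\<exists>a\<in>A. s \<sqsubseteq> a"
  then obtain a where a: "a \<in> A" "s \<sqsubseteq> a" by auto
  have "a \<sqsubseteq> \<Squnion>A" using A a(1) by (rule sup_upper)
  then show "s \<sqsubseteq> \<Squnion>A" using a sL A by (meson le_trans subsetD sup_closed)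
qed

text \<open>
  This says that every element is the join of the supercompact elements below it, in a form that
  reduces inequalities to inequalities with a supercompact left-hand side, where
  join-primeness applies.
\<close>

definition supercompactly_generated :: "'a gorder \<Rightarrow> bool" where
  "supercompactly_generated L \<longleftrightarrow> frame L \<and>
     (\<forall>a\<in>carrier L. \<forall>b\<in>carrier L.
        (\<forall>s. supercompact L s \<and> s \<sqsubseteq>\<^bsub>L\<^esub> a \<longrightarrow> s \<sqsubseteq>\<^bsub>L\<^esub> b) \<longrightarrow> a \<sqsubseteq>\<^bsub>L\<^esub> b)"

lemma frame_partial_order: "frame L \<Longrightarrow> partial_order L"
  by (simp add: frame_def complete_lattice_def)

lemma frame_complete_lattice: "frame L \<Longrightarrow> complete_lattice L"
  by (simp add: frame_def)

context order_isomorphism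
begin

lemma Collect_supercompact_transport:
  assumes "complete_lattice L"
  shows "Collect (supercompact M) = f ` Collect (supercompact L)"
proof
  show "f ` Collect (supercompact L) \<subseteq> Collect (supercompact M)"
    using supercompact_transport[OF assms] by auto
  show "Collect (supercompact M) \<subseteq> f ` Collect (supercompact L)"
  proof
    fix t assume "t \<in> Collect (supercompact M)"
    then have t: "supercompact M t" by simp
    then have "supercompact L (g t)"
      by (rule order_isomorphism.supercompact_transport[OF inverse
            complete_lattice_transport[OF assms]])
    moreover have "t = f (g t)" using f_g supercompact_closed[OF t] by simp
    ultimately show "t \<in> f ` Collect (supercompact L)" by blast
  qed
qed

lemma supercompactly_generated_transport:
  assumes L: "supercompactly_generated L"
  shows "supercompactly_generated M"
  unfolding supercompactly_generated_def
proof (intro conjI ballI impI)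
  have fL: "frame L" using L by (simp add: supercompactly_generated_def)
  then show "frame M" by (rule frame_transport)
  fix a b assume a: "a \<in> carrier M" and b: "b \<in> carrier M"
    and le: "\<forall>s. supercompact M s \<and> s \<sqsubseteq>\<^bsub>M\<^esub> a \<longrightarrow> s \<sqsubseteq>\<^bsub>M\<^esub> b"
  have "s \<sqsubseteq>\<^bsub>L\<^esub> g b" if s: "supercompact L s" "s \<sqsubseteq>\<^bsub>L\<^esub> g a" for s
  proof -
    have "supercompact M (f s)"
      using supercompact_transport[OF frame_complete_lattice[OF fL] s(1)] .
    then show ?thesis
      using le s f_le_iff_le_g[OF supercompact_closed[OF s(1)]] a b by blast
  qed
  then have "g a \<sqsubseteq>\<^bsub>L\<^esub> g b"
    using L g_closed[OF a] g_closed[OF b] unfolding supercompactly_generated_def by blast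
  then show "a \<sqsubseteq>\<^bsub>M\<^esub> b" using f_le_iff_le_g[OF g_closed[OF a] b] f_g[OF a] by simp
qed

end

lemma supercompactly_generated_upper_set_frame:
  assumes r: "reflp_on A r" "transp_on A r"
  shows "supercompactly_generated (upper_set_frame A r)"
  unfolding supercompactly_generated_def
proof (intro conjI ballI impI frame_upper_set_frame)
  fix S T assume S: "S \<in> carrier (upper_set_frame A r)" and T: "T \<in> carrier (upper_set_frame A r)"
    and le: "\<forall>s. supercompact (upper_set_frame A r) s \<and> s \<sqsubseteq>\<^bsub>upper_set_frame A r\<^esub> S
      \<longrightarrow> s \<sqsubseteq>\<^bsub>upper_set_frame A r\<^esub> T"
  have "x \<in> T" if "x \<in> S" for x
  proof -
    have x: "x \<in> A" using that S by (auto simp: upper_sets_def)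
    then show ?thesis
      using le that S T principal_upper_set_subset_iff[OF r(1) x]
      unfolding supercompact_upper_set_frame_iff[OF r] upper_set_frame_simps by metis
  qed
  then show "S \<sqsubseteq>\<^bsub>upper_set_frame A r\<^esub> T" by auto
qed

lemma order_isomorphism_of_isomorphic_locales:
  assumes "isomorphic_locales L M"
  obtains f g where "order_isomorphism L M f g"
proof -
  obtain f g where f: "frame_hom L M f" and g: "frame_hom M L g"
    and gf: "\<forall>x\<in>carrier L. g (f x) = x" and fg: "\<forall>y\<in>carrier M. f (g y) = y"
    using assms unfolding isomorphic_locales_def by blast
  have fc: "f \<in> carrier L \<rightarrow> carrier M" and gc: "g \<in> carrier M \<rightarrow> carrier L"
    using f g by (simp_all add: frame_hom_def)
  have fi: "isotone L M f" using meet_pres_isotone[OF fc] f by (simp add: frame_hom_def)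
  have gi: "isotone M L g" using meet_pres_isotone[OF gc] g by (simp add: frame_hom_def)
  have "order_isomorphism L M f g"
  proof (intro order_isomorphism.intro order_isomorphism_axioms.intro)
    show "partial_order L" "partial_order M"
      using f by (simp_all add: frame_hom_def frame_partial_order)
    fix x x' assume x: "x \<in> carrier L" "x' \<in> carrier L"
    show "f x \<sqsubseteq>\<^bsub>M\<^esub> f x' \<longleftrightarrow> x \<sqsubseteq>\<^bsub>L\<^esub> x'"
    proof
      assume "f x \<sqsubseteq>\<^bsub>M\<^esub> f x'"
      then have "g (f x) \<sqsubseteq>\<^bsub>L\<^esub> g (f x')" using use_iso2[OF gi] x fc by blast
      then show "x \<sqsubseteq>\<^bsub>L\<^esub> x'" using gf x by simp
    next
      assume "x \<sqsubseteq>\<^bsub>L\<^esub> x'"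
      then show "f x \<sqsubseteq>\<^bsub>M\<^esub> f x'" using use_iso2[OF fi] x by blast
    qed
  qed (use fc gc gf fg in auto)
  then show ?thesis by (rule that)
qed

lemma supercompactly_generated_alexandrov:
  assumes "alexandrov_locale small L"
  shows "supercompactly_generated L"
proof -
  obtain A :: "'a set" and r where r: "reflp_on A r" "transp_on A r"
    and iso: "isomorphic_locales L (upper_set_frame A r)"
    using assms unfolding alexandrov_locale_def by blast
  obtain f g where "order_isomorphism L (upper_set_frame A r) f g"
    using order_isomorphism_of_isomorphic_locales[OF iso] .
  then show ?thesis
    using order_isomorphism.supercompactly_generated_transport[OF order_isomorphism.inverse]
      supercompactly_generated_upper_set_frame[OF r] by blast
qed

text \<open>
  The principal upper sets are indexed by the elements of the small preorder that presents \<open>L\<close>.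
\<close>

lemma (in universe) small_supercompact:
  assumes "alexandrov_locale small L"
  shows "small (Collect (supercompact L))"
proof -
  obtain A :: "'u set" and r where A: "small A" and r: "reflp_on A r" "transp_on A r"
    and iso: "isomorphic_locales L (upper_set_frame A r)"
    using assms unfolding alexandrov_locale_def by blast
  obtain f g where fg: "order_isomorphism L (upper_set_frame A r) f g"
    using order_isomorphism_of_isomorphic_locales[OF iso] .
  have "Collect (supercompact L) = g ` Collect (supercompact (upper_set_frame A r))"
    by (rule order_isomorphism.Collect_supercompact_transport[OF order_isomorphism.inverse[OF fg]])
      (rule frame_complete_lattice[OF frame_upper_set_frame])
  also have "Collect (supercompact (upper_set_frame A r)) = principal_upper_set A r ` A"
    using supercompact_upper_set_frame_iff[OF r] by auto
  finally show ?thesis using small_image[OF A, of "\<lambda>x. g (principal_upper_set A r x)"]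
    by (simp add: image_image)
qed

section \<open>Left adjoints and complete maps\<close>

lemma is_left_adjoint_iff:
  "is_left_adjoint L L' g l \<longleftrightarrow> partial_order L \<and> partial_order L' \<and>
     l \<in> carrier L \<rightarrow> carrier L' \<and> g \<in> carrier L' \<rightarrow> carrier L \<and>
     (\<forall>x\<in>carrier L. \<forall>y\<in>carrier L'. l x \<sqsubseteq>\<^bsub>L'\<^esub> y \<longleftrightarrow> x \<sqsubseteq>\<^bsub>L\<^esub> g y)"
  by (auto simp: is_left_adjoint_def galois_connection_def connection_def galois_connection_axioms_def)

text \<open>
  The upper bounds of \<open>l x\<close> are the elements \<open>y\<close> with \<open>x \<le> g y\<close>, which does not mention \<open>l\<close>.
\<close>

lemma is_left_adjoint_unique:
  assumes "is_left_adjoint L L' g l" "is_left_adjoint L L' g l'" and x: "x \<in> carrier L"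
  shows "l x = l' x"
proof -
  interpret L': partial_order L' using assms(1) by (simp add: is_left_adjoint_iff)
  have l: "l x \<in> carrier L'" "l' x \<in> carrier L'"
    using assms by (auto simp: is_left_adjoint_iff)
  have "l x \<sqsubseteq>\<^bsub>L'\<^esub> y \<longleftrightarrow> l' x \<sqsubseteq>\<^bsub>L'\<^esub> y" if "y \<in> carrier L'" for y
    using assms that by (simp add: is_left_adjoint_iff)
  then show ?thesis using l by (intro L'.le_antisym) auto
qed

lemma left_adjoint_eq:
  assumes l: "is_left_adjoint L L' g l"
  shows "left_adjoint L L' g = restrict l (carrier L)"
  unfolding left_adjoint_def
proof (rule the_equality)
  show "restrict l (carrier L) \<in> extensional (carrier L) \<and>
      is_left_adjoint L L' g (restrict l (carrier L))"
    using l by (auto simp: is_left_adjoint_iff)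
  fix l' assume l': "l' \<in> extensional (carrier L) \<and> is_left_adjoint L L' g l'"
  then show "l' = restrict l (carrier L)"
    using is_left_adjoint_unique[OF _ l, of l'] by (intro extensionalityI[of _ "carrier L"]) auto
qed

lemma is_left_adjoint_id: "partial_order L \<Longrightarrow> is_left_adjoint L L (\<lambda>x\<in>carrier L. x) (\<lambda>x. x)"
  by (auto simp: is_left_adjoint_iff)

lemma is_left_adjoint_compose:
  assumes "is_left_adjoint L L' g l" "is_left_adjoint L' L'' h k"
  shows "is_left_adjoint L L'' (compose (carrier L'') g h) (\<lambda>x. k (l x))"
  using assms by (auto simp: is_left_adjoint_iff compose_def Pi_iff)

lemma (in order_isomorphism) is_left_adjoint:
  "is_left_adjoint L M (restrict g (carrier M)) f"
  using L.partial_order_axioms M.partial_order_axioms f_le_iff_le_g f_closed g_closed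
  by (auto simp: is_left_adjoint_iff)

text \<open>
  A map with a left adjoint preserves meets. For joins, the inequality
  \<open>g (\<Squnion>A) \<le> \<Squnion>(g ` A)\<close> is tested on supercompact \<open>s\<close>: from \<open>s \<le> g (\<Squnion>A)\<close> follows \<open>l s \<le> \<Squnion>A\<close>, and as
  \<open>l s\<close> is supercompact it lies below some \<open>a \<in> A\<close>, so that \<open>s \<le> g a\<close>. Hence the complete maps are
  recognised from their left adjoints alone.
\<close>

lemma complete_mapI:
  assumes L: "supercompactly_generated L" and L': "frame L'"
    and adj: "is_left_adjoint L L' g l"
    and sc: "\<And>s. supercompact L s \<Longrightarrow> supercompact L' (l s)"
  shows "complete_map L L' g"
proof -
  interpret L: frame L using L by (simp add: supercompactly_generated_def)
  interpret L': frame L' by (rule L')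
  have g: "g y \<in> carrier L" if "y \<in> carrier L'" for y
    using adj that by (auto simp: is_left_adjoint_iff)
  have l: "l x \<in> carrier L'" if "x \<in> carrier L" for x
    using adj that by (auto simp: is_left_adjoint_iff)
  have le: "l x \<sqsubseteq>\<^bsub>L'\<^esub> y \<longleftrightarrow> x \<sqsubseteq>\<^bsub>L\<^esub> g y" if "x \<in> carrier L" "y \<in> carrier L'" for x y
    using adj that by (simp add: is_left_adjoint_iff)
  have ge: "a \<sqsubseteq>\<^bsub>L\<^esub> b" if "a \<in> carrier L" "b \<in> carrier L"
    "\<And>s. supercompact L s \<Longrightarrow> s \<sqsubseteq>\<^bsub>L\<^esub> a \<Longrightarrow> s \<sqsubseteq>\<^bsub>L\<^esub> b" for a b
    using L that unfolding supercompactly_generated_def by blast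
  have inf: "g (\<Sqinter>\<^bsub>L'\<^esub> A) = \<Sqinter>\<^bsub>L\<^esub> (g ` A)" if A: "A \<subseteq> carrier L'" for A
  proof (rule L.le_antisym)
    have gA: "g ` A \<subseteq> carrier L" using A g by auto
    have lower: "x \<sqsubseteq>\<^bsub>L\<^esub> g (\<Sqinter>\<^bsub>L'\<^esub> A) \<longleftrightarrow> (\<forall>a\<in>A. x \<sqsubseteq>\<^bsub>L\<^esub> g a)" if x: "x \<in> carrier L" for x
    proof -
      have "x \<sqsubseteq>\<^bsub>L\<^esub> g (\<Sqinter>\<^bsub>L'\<^esub> A) \<longleftrightarrow> l x \<sqsubseteq>\<^bsub>L'\<^esub> \<Sqinter>\<^bsub>L'\<^esub> A" using le x A by simp
      also have "\<dots> \<longleftrightarrow> (\<forall>a\<in>A. l x \<sqsubseteq>\<^bsub>L'\<^esub> a)"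
        using L'.inf_lower[OF A] L'.inf_greatest[OF A l[OF x]] L'.le_trans[OF _ _ l[OF x]] A
        by (meson L'.inf_closed subsetD)
      also have "\<dots> \<longleftrightarrow> (\<forall>a\<in>A. x \<sqsubseteq>\<^bsub>L\<^esub> g a)" using le[OF x] A by (meson subsetD)
      finally show ?thesis .
    qed
    show "g (\<Sqinter>\<^bsub>L'\<^esub> A) \<sqsubseteq>\<^bsub>L\<^esub> \<Sqinter>\<^bsub>L\<^esub> (g ` A)"
      by (rule L.inf_greatest[OF gA]) (use g A lower[of "g (\<Sqinter>\<^bsub>L'\<^esub> A)"] in auto)
    show "\<Sqinter>\<^bsub>L\<^esub> (g ` A) \<sqsubseteq>\<^bsub>L\<^esub> g (\<Sqinter>\<^bsub>L'\<^esub> A)"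
      using lower[of "\<Sqinter>\<^bsub>L\<^esub> (g ` A)"] L.inf_lower[OF gA] gA by simp
    show "g (\<Sqinter>\<^bsub>L'\<^esub> A) \<in> carrier L" using g A by simp
    show "\<Sqinter>\<^bsub>L\<^esub> (g ` A) \<in> carrier L" using gA by simp
  qed
  have meet: "g (x \<sqinter>\<^bsub>L'\<^esub> y) = g x \<sqinter>\<^bsub>L\<^esub> g y" if "x \<in> carrier L'" "y \<in> carrier L'" for x y
    using inf[of "{x, y}"] that by (simp add: meet_def)
  have top: "g \<top>\<^bsub>L'\<^esub> = \<top>\<^bsub>L\<^esub>" using inf[of "{}"]
      complete_lattice.inf_empty[OF L.complete_lattice_axioms]
      complete_lattice.inf_empty[OF L'.complete_lattice_axioms] by simp
  have sup: "g (\<Squnion>\<^bsub>L'\<^esub> A) = \<Squnion>\<^bsub>L\<^esub> (g ` A)" if A: "A \<subseteq> carrier L'" for A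
  proof -
    have gA: "g ` A \<subseteq> carrier L" using A g by auto
    have below: "s \<sqsubseteq>\<^bsub>L\<^esub> g (\<Squnion>\<^bsub>L'\<^esub> A) \<longleftrightarrow> s \<sqsubseteq>\<^bsub>L\<^esub> \<Squnion>\<^bsub>L\<^esub> (g ` A)" if s: "supercompact L s" for s
    proof -
      have sL: "s \<in> carrier L" using s by (rule supercompact_closed)
      have "s \<sqsubseteq>\<^bsub>L\<^esub> g (\<Squnion>\<^bsub>L'\<^esub> A) \<longleftrightarrow> l s \<sqsubseteq>\<^bsub>L'\<^esub> \<Squnion>\<^bsub>L'\<^esub> A" using le sL A by simp
      also have "\<dots> \<longleftrightarrow> (\<exists>a\<in>A. l s \<sqsubseteq>\<^bsub>L'\<^esub> a)"
        by (rule supercompact_le_sup_iff[OF L' sc[OF s] A])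
      also have "\<dots> \<longleftrightarrow> (\<exists>a\<in>A. s \<sqsubseteq>\<^bsub>L\<^esub> g a)" using le[OF sL] A by (meson subsetD)
      also have "\<dots> \<longleftrightarrow> s \<sqsubseteq>\<^bsub>L\<^esub> \<Squnion>\<^bsub>L\<^esub> (g ` A)"
        using supercompact_le_sup_iff[OF L.frame_axioms s gA] by simp
      finally show ?thesis .
    qed
    have closed: "g (\<Squnion>\<^bsub>L'\<^esub> A) \<in> carrier L" "\<Squnion>\<^bsub>L\<^esub> (g ` A) \<in> carrier L" using g A gA by simp_all
    show ?thesis
      by (rule L.le_antisym[OF ge[OF closed] ge[OF closed(2,1)] closed]) (simp_all add: below)
  qed
  have "frame_hom L' L g"
    unfolding frame_hom_def sup_pres_def meet_pres_def
    using L.frame_axioms L'.frame_axioms L.complete_lattice_axioms L'.complete_lattice_axioms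
      L.lattice_axioms L'.lattice_axioms g sup meet top by auto
  then show ?thesis unfolding complete_map_def using adj sc by blast
qed

lemma complete_map_left_adjoint:
  assumes "complete_map L L' g"
  shows "is_left_adjoint L L' g (left_adjoint L L' g)"
    and "supercompact L s \<Longrightarrow> supercompact L' (left_adjoint L L' g s)"
proof -
  obtain l where l: "is_left_adjoint L L' g l" "\<And>s. supercompact L s \<Longrightarrow> supercompact L' (l s)"
    using assms unfolding complete_map_def by blast
  show "is_left_adjoint L L' g (left_adjoint L L' g)"
    unfolding left_adjoint_eq[OF l(1)] using l(1) by (auto simp: is_left_adjoint_iff)
  show "supercompact L s \<Longrightarrow> supercompact L' (left_adjoint L L' g s)"
    unfolding left_adjoint_eq[OF l(1)] using l(2) by (simp add: supercompact_closed)
qed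

lemma complete_map_id:
  assumes "supercompactly_generated L"
  shows "complete_map L L (\<lambda>x\<in>carrier L. x)"
proof -
  have "frame L" using assms by (simp add: supercompactly_generated_def)
  then show ?thesis
    using complete_mapI[OF assms _ is_left_adjoint_id] frame_partial_order by blast
qed

lemma complete_map_compose:
  assumes "supercompactly_generated L" "complete_map L L' g" "complete_map L' L'' h"
  shows "complete_map L L'' (compose (carrier L'') g h)"
proof (rule complete_mapI[OF assms(1)])
  show "frame L''" using assms(3) by (simp add: complete_map_def frame_hom_def)
  show "is_left_adjoint L L'' (compose (carrier L'') g h)
     (\<lambda>x. left_adjoint L' L'' h (left_adjoint L L' g x))"
    by (rule is_left_adjoint_compose[OF complete_map_left_adjoint(1)[OF assms(2)]
          complete_map_left_adjoint(1)[OF assms(3)]])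
qed (intro complete_map_left_adjoint assms)

lemma (in order_isomorphism) complete_map:
  assumes "supercompactly_generated L"
  shows "complete_map L M (restrict g (carrier M))"
proof (rule complete_mapI[OF assms _ is_left_adjoint])
  have L: "frame L" using assms by (simp add: supercompactly_generated_def)
  then show "frame M" by (rule frame_transport)
  show "supercompact L s \<Longrightarrow> supercompact M (f s)" for s
    by (rule supercompact_transport[OF frame_complete_lattice[OF L]])
qed

section \<open>The categories of posets and of Alexandrov locales\<close>

lemma Pos_simps [simp]:
  "P \<in> Obj (Pos small) \<longleftrightarrow> partial_order P \<and> order_on_carrier P \<and> small (carrier P)"
  "Idn (Pos small) P = (\<lambda>x\<in>carrier P. x)"
  "Cmp (Pos small) P Q R g f = compose (carrier P) g f"
  by (simp_all add: Pos_def)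

lemma AlexLoc_simps [simp]:
  "L \<in> Obj (AlexLoc small) \<longleftrightarrow> alexandrov_locale small L \<and> order_on_carrier L"
  "Idn (AlexLoc small) L = (\<lambda>x\<in>carrier L. x)"
  "Cmp (AlexLoc small) L L' L'' h g = compose (carrier L'') g h"
  "g \<in> Hom (AlexLoc small) L L' \<longleftrightarrow> g \<in> carrier L' \<rightarrow>\<^sub>E carrier L \<and> complete_map L L' g"
  by (simp_all add: AlexLoc_def)

lemma Pos_Hom_iff:
  assumes "partial_order P" "partial_order Q"
  shows "f \<in> Hom (Pos small) P Q \<longleftrightarrow> f \<in> carrier P \<rightarrow>\<^sub>E carrier Q \<and>
    (\<forall>x\<in>carrier P. \<forall>y\<in>carrier P. x \<sqsubseteq>\<^bsub>P\<^esub> y \<longrightarrow> f x \<sqsubseteq>\<^bsub>Q\<^esub> f y)"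
  using assms partial_order.axioms(1) by (auto simp: Pos_def isotone_def)

lemma category_Pos: "category (Pos small)"
proof
  fix X Y Z :: "'a gorder" and f g
  assume X: "X \<in> Obj (Pos small)" and Y: "Y \<in> Obj (Pos small)" and Z: "Z \<in> Obj (Pos small)"
    and f: "f \<in> Hom (Pos small) X Y" and g: "g \<in> Hom (Pos small) Y Z"
  show "Cmp (Pos small) X Y Z g f \<in> Hom (Pos small) X Z"
    using X Y Z f g by (auto simp: Pos_Hom_iff compose_def PiE_iff)
next
  fix X Y :: "'a gorder" and f
  assume X: "X \<in> Obj (Pos small)" and Y: "Y \<in> Obj (Pos small)" and f: "f \<in> Hom (Pos small) X Y"
  then have fE: "f \<in> carrier X \<rightarrow> carrier Y" "f \<in> extensional (carrier X)"
    by (auto simp: Pos_Hom_iff PiE_iff)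
  show "Cmp (Pos small) X X Y f (Idn (Pos small) X) = f" using compose_Id[OF fE] by simp
  show "Cmp (Pos small) X Y Y (Idn (Pos small) Y) f = f" using Id_compose[OF fE] by simp
next
  fix W X Y Z :: "'a gorder" and f g h
  assume "W \<in> Obj (Pos small)" "X \<in> Obj (Pos small)" "f \<in> Hom (Pos small) W X"
  then have "f \<in> carrier W \<rightarrow> carrier X" by (auto simp: Pos_Hom_iff)
  then show "Cmp (Pos small) W X Z (Cmp (Pos small) X Y Z h g) f
      = Cmp (Pos small) W Y Z h (Cmp (Pos small) W X Y g f)"
    by (simp add: compose_assoc)
qed (auto simp: Pos_Hom_iff)

lemma category_AlexLoc: "category (AlexLoc small)"
proof
  show "Idn (AlexLoc small) X \<in> Hom (AlexLoc small) X X" if "X \<in> Obj (AlexLoc small)" for X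
    using that complete_map_id supercompactly_generated_alexandrov by auto
next
  fix X Y Z :: "'a gorder" and f g
  assume X: "X \<in> Obj (AlexLoc small)"
    and f: "f \<in> Hom (AlexLoc small) X Y" and g: "g \<in> Hom (AlexLoc small) Y Z"
  show "Cmp (AlexLoc small) X Y Z g f \<in> Hom (AlexLoc small) X Z"
    using f g complete_map_compose[OF supercompactly_generated_alexandrov] X
    by (auto simp: compose_def PiE_iff)
next
  fix X Y :: "'a gorder" and f
  assume f: "f \<in> Hom (AlexLoc small) X Y"
  then have fE: "f \<in> carrier Y \<rightarrow> carrier X" "f \<in> extensional (carrier Y)"
    by (auto simp: PiE_iff)
  show "Cmp (AlexLoc small) X X Y f (Idn (AlexLoc small) X) = f" using Id_compose[OF fE] by simp
  show "Cmp (AlexLoc small) X Y Y (Idn (AlexLoc small) Y) f = f" using compose_Id[OF fE] by simp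
next
  fix W X Y Z :: "'a gorder" and f g h
  assume "h \<in> Hom (AlexLoc small) Y Z"
  then have "h \<in> carrier Z \<rightarrow> carrier Y" by auto
  then show "Cmp (AlexLoc small) W X Z (Cmp (AlexLoc small) X Y Z h g) f
      = Cmp (AlexLoc small) W Y Z h (Cmp (AlexLoc small) W X Y g f)"
    by (simp add: compose_assoc)
qed

lemma (in order_isomorphism) compose_restrict:
  "compose (carrier L) (restrict g (carrier M)) (restrict f (carrier L)) = (\<lambda>x\<in>carrier L. x)"
  by (auto simp: compose_def f_closed g_f)

lemma iso_arrow_Pos:
  assumes iso: "order_isomorphism P Q f g" and "P \<in> Obj (Pos small)" "Q \<in> Obj (Pos small)"
  shows "iso_arrow (Pos small) P Q (restrict f (carrier P))"
proof -
  have arr: "restrict f' (carrier P') \<in> Hom (Pos small) P' Q'"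
    if "order_isomorphism P' Q' f' g'" for P' Q' f' g'
  proof -
    interpret order_isomorphism P' Q' f' g' by fact
    show ?thesis
      using f_closed f_le_iff
      by (auto simp: Pos_Hom_iff L.partial_order_axioms M.partial_order_axioms)
  qed
  note inv = order_isomorphism.inverse[OF iso]
  show ?thesis
    unfolding iso_arrow_def
    using arr[OF iso] arr[OF inv] order_isomorphism.compose_restrict[OF iso]
      order_isomorphism.compose_restrict[OF inv] by auto
qed

lemma iso_arrow_AlexLoc:
  assumes iso: "order_isomorphism L M f g"
    and "L \<in> Obj (AlexLoc small)" "M \<in> Obj (AlexLoc small)"
  shows "iso_arrow (AlexLoc small) L M (restrict g (carrier M))"
proof -
  note inv = order_isomorphism.inverse[OF iso]
  have sg: "supercompactly_generated L" "supercompactly_generated M"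
    using assms(2,3) supercompactly_generated_alexandrov by auto
  have "restrict g (carrier M) \<in> Hom (AlexLoc small) L M"
    using order_isomorphism.complete_map[OF iso sg(1)] order_isomorphism.g_closed[OF iso] by auto
  moreover have "restrict f (carrier L) \<in> Hom (AlexLoc small) M L"
    using order_isomorphism.complete_map[OF inv sg(2)] order_isomorphism.g_closed[OF inv] by auto
  ultimately show ?thesis
    unfolding iso_arrow_def
    using order_isomorphism.compose_restrict[OF iso] order_isomorphism.compose_restrict[OF inv]
    by auto
qed

lemma cat_functor_id: "category C \<Longrightarrow> cat_functor C C id_functor"
  by (simp add: cat_functor_def cat_functor_axioms_def id_functor_def)

lemma cat_functor_comp:
  assumes F: "cat_functor C D F" and G: "cat_functor D E G"
  shows "cat_functor C E (comp_functor G F)"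
proof -
  interpret F: cat_functor C D F by (rule F)
  interpret G: cat_functor D E G by (rule G)
  show ?thesis
    by unfold_locales
      (simp_all add: comp_functor_def F.FObj_in_Obj G.FObj_in_Obj F.FArr_in_Hom G.FArr_in_Hom
        F.FArr_Idn G.FArr_Idn F.FArr_Cmp G.FArr_Cmp)
qed

section \<open>The locale of upper sets of a poset\<close>

abbreviation upsets :: "'a gorder \<Rightarrow> 'a set set" where
  "upsets P \<equiv> upper_sets (carrier P) (le P)"

abbreviation up :: "'a gorder \<Rightarrow> 'a \<Rightarrow> 'a set" where
  "up P x \<equiv> principal_upper_set (carrier P) (le P) x"

lemma reflp_on_partial_order: "partial_order P \<Longrightarrow> reflp_on (carrier P) (le P)"
  by (rule reflp_onI) (rule weak_partial_order.le_refl[OF partial_order.axioms(1)])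

lemma transp_on_partial_order: "partial_order P \<Longrightarrow> transp_on (carrier P) (le P)"
  by (rule transp_onI) (rule weak_partial_order.le_trans[OF partial_order.axioms(1)])

lemma up_in_upsets: "partial_order P \<Longrightarrow> x \<in> carrier P \<Longrightarrow> up P x \<in> upsets P"
  by (rule principal_upper_set_in_upper_sets[OF transp_on_partial_order])

lemma up_subset_iff:
  "partial_order P \<Longrightarrow> x \<in> carrier P \<Longrightarrow> S \<in> upsets P \<Longrightarrow> up P x \<subseteq> S \<longleftrightarrow> x \<in> S"
  by (rule principal_upper_set_subset_iff[OF reflp_on_partial_order])

lemma carrier_B_Pos_obj: "carrier (B_Pos_obj code P) = code ` upsets P"
  by (simp add: B_Pos_obj_def Let_def)

context universe
begin

lemma code_eq_iff:
  assumes "small A" "S \<subseteq> A" "T \<subseteq> A"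
  shows "code S = code T \<longleftrightarrow> S = T"
  using inj_on_eq_iff[OF code_inj, of S T] small_subset[OF assms(1)] assms(2,3) by simp

lemma code_upsets_eq_iff:
  "small (carrier P) \<Longrightarrow> S \<in> upsets P \<Longrightarrow> T \<in> upsets P \<Longrightarrow> code S = code T \<longleftrightarrow> S = T"
  by (rule code_eq_iff) (auto simp: upper_sets_def)

lemma le_B_Pos_obj_iff:
  assumes "small (carrier P)" "S \<in> upsets P" "T \<in> upsets P"
  shows "code S \<sqsubseteq>\<^bsub>B_Pos_obj code P\<^esub> code T \<longleftrightarrow> S \<subseteq> T"
proof -
  have "code S \<sqsubseteq>\<^bsub>B_Pos_obj code P\<^esub> code T \<longleftrightarrow>
      (\<exists>S'\<in>upsets P. \<exists>T'\<in>upsets P. code S = code S' \<and> code T = code T' \<and> S' \<subseteq> T')"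
    by (simp add: B_Pos_obj_def Let_def)
  also have "\<dots> \<longleftrightarrow> (\<exists>S'\<in>upsets P. \<exists>T'\<in>upsets P. S = S' \<and> T = T' \<and> S' \<subseteq> T')"
    using assms(2,3) by (simp add: code_upsets_eq_iff[OF assms(1)] cong: bex_cong)
  also have "\<dots> \<longleftrightarrow> S \<subseteq> T" using assms(2,3) by blast
  finally show ?thesis .
qed

lemma partial_order_B_Pos_obj:
  assumes "small (carrier P)"
  shows "partial_order (B_Pos_obj code P)"
  by (rule gorder_partial_orderI)
    (auto simp: carrier_B_Pos_obj le_B_Pos_obj_iff[OF assms], simp add: B_Pos_obj_def Let_def)

text \<open>
  The locale of upper sets, whose elements are names of upper sets, inherits all its properties
  from the frame of upper sets along this isomorphism.
\<close>

lemma order_isomorphism_code: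
  assumes "small (carrier P)"
  shows "order_isomorphism (upper_set_frame (carrier P) (le P)) (B_Pos_obj code P)
    code (inv_into (upsets P) code)"
  using order_isomorphism_of_surj_embedding[OF partial_order_upper_set_frame
      partial_order_B_Pos_obj[OF assms], where f = code]
  by (simp add: carrier_B_Pos_obj le_B_Pos_obj_iff[OF assms])

lemma frame_B_Pos_obj: "small (carrier P) \<Longrightarrow> frame (B_Pos_obj code P)"
  by (rule order_isomorphism.frame_transport[OF order_isomorphism_code frame_upper_set_frame])

lemma supercompactly_generated_B_Pos_obj:
  assumes "partial_order P" "small (carrier P)"
  shows "supercompactly_generated (B_Pos_obj code P)"
  by (intro order_isomorphism.supercompactly_generated_transport[OF order_isomorphism_code]
      supercompactly_generated_upper_set_frame reflp_on_partial_order transp_on_partial_order assms)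

lemma Collect_supercompact_B_Pos_obj:
  assumes "partial_order P" "small (carrier P)"
  shows "Collect (supercompact (B_Pos_obj code P)) = (\<lambda>x. code (up P x)) ` carrier P"
proof -
  have "Collect (supercompact (upper_set_frame (carrier P) (le P))) = up P ` carrier P"
    using supercompact_upper_set_frame_iff[OF reflp_on_partial_order transp_on_partial_order, OF assms(1,1)]
    by auto
  then show ?thesis
    using order_isomorphism.Collect_supercompact_transport[OF order_isomorphism_code[OF assms(2)]
        frame_complete_lattice[OF frame_upper_set_frame]]
    by (simp add: image_image)
qed

lemma B_Pos_obj_in_AlexLoc:
  assumes P: "P \<in> Obj (Pos small)"
  shows "B_Pos_obj code P \<in> Obj (AlexLoc small)"
proof -
  have P: "partial_order P" "small (carrier P)" using P by simp_all
  have "isomorphic_locales (B_Pos_obj code P) (upper_set_frame (carrier P) (le P))"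
    by (rule order_isomorphism.isomorphic_locales[OF order_isomorphism.inverse[OF
            order_isomorphism_code[OF P(2)]] frame_B_Pos_obj[OF P(2)]])
  then have "alexandrov_locale small (B_Pos_obj code P)"
    unfolding alexandrov_locale_def
    using P frame_B_Pos_obj reflp_on_partial_order transp_on_partial_order by blast
  moreover have "order_on_carrier (B_Pos_obj code P)"
    by (auto simp: order_on_carrier_def B_Pos_obj_def Let_def)
  ultimately show ?thesis by simp
qed

lemma B_Pos_arr_code:
  assumes "small (carrier Q)" "S \<in> upsets Q"
  shows "B_Pos_arr code P Q f (code S) = code {x \<in> carrier P. f x \<in> S}"
proof -
  have "inv_into (upsets Q) code (code S) = S"
    using order_isomorphism.g_f[OF order_isomorphism_code[OF assms(1)], of S] assms(2) by simp
  moreover have "f -` S \<inter> carrier P = {x \<in> carrier P. f x \<in> S}" by auto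
  ultimately show ?thesis
    using assms(2) by (simp add: B_Pos_arr_def carrier_B_Pos_obj)
qed

lemma preimage_in_upsets:
  assumes P: "partial_order P" "partial_order Q" and f: "f \<in> Hom (Pos small) P Q"
    and S: "S \<in> upsets Q"
  shows "{x \<in> carrier P. f x \<in> S} \<in> upsets P"
  using f S unfolding Pos_Hom_iff[OF P] upper_sets_def by blast

text \<open>
  The left adjoint of the inverse image takes an upper set to the upper closure of its direct
  image, written here as a union of principal upper sets. On principal upper sets it is \<open>f\<close>
  itself (\<open>left_adjoint_B_Pos_arr\<close>), so it preserves supercompact elements.
\<close>

lemma is_left_adjoint_B_Pos_arr:
  assumes P: "P \<in> Obj (Pos small)" and Q: "Q \<in> Obj (Pos small)" and f: "f \<in> Hom (Pos small) P Q"
  shows "is_left_adjoint (B_Pos_obj code P) (B_Pos_obj code Q) (B_Pos_arr code P Q f)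
    (\<lambda>u. code (\<Union>x\<in>inv_into (upsets P) code u. up Q (f x)))"
    (is "is_left_adjoint _ _ _ ?l")
proof -
  have po: "partial_order P" "partial_order Q" and sm: "small (carrier P)" "small (carrier Q)"
    using P Q by simp_all
  have fc: "f x \<in> carrier Q" if "x \<in> carrier P" for x
    using f that by (auto simp: Pos_Hom_iff[OF po])
  have l: "?l (code S) = code (\<Union>x\<in>S. up Q (f x))" if "S \<in> upsets P" for S
    using order_isomorphism.g_f[OF order_isomorphism_code[OF sm(1)], of S] that by simp
  have ups: "(\<Union>x\<in>S. up Q (f x)) \<in> upsets Q" if "S \<in> upsets P" for S
  proof (rule upper_sets_Union)
    have "S \<subseteq> carrier P" using that by (simp add: upper_sets_def)
    then show "(\<lambda>x. up Q (f x)) ` S \<subseteq> upsets Q"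
      using up_in_upsets[OF po(2) fc] by blast
  qed
  have adj: "(\<Union>x\<in>S. up Q (f x)) \<subseteq> T \<longleftrightarrow> S \<subseteq> {x \<in> carrier P. f x \<in> T}"
    if S: "S \<in> upsets P" and T: "T \<in> upsets Q" for S T
  proof -
    have SP: "S \<subseteq> carrier P" using S by (simp add: upper_sets_def)
    then have "(\<Union>x\<in>S. up Q (f x)) \<subseteq> T \<longleftrightarrow> (\<forall>x\<in>S. f x \<in> T)"
      using up_subset_iff[OF po(2) fc T] by (simp add: UN_subset_iff subsetD[OF SP])
    then show ?thesis using SP by auto
  qed
  show ?thesis
    unfolding is_left_adjoint_iff carrier_B_Pos_obj
    using partial_order_B_Pos_obj sm ups adj preimage_in_upsets[OF po f]
    by (auto simp: l B_Pos_arr_code le_B_Pos_obj_iff)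
qed

lemma left_adjoint_B_Pos_arr:
  assumes P: "P \<in> Obj (Pos small)" and Q: "Q \<in> Obj (Pos small)" and f: "f \<in> Hom (Pos small) P Q"
    and x: "x \<in> carrier P"
  shows "left_adjoint (B_Pos_obj code P) (B_Pos_obj code Q) (B_Pos_arr code P Q f) (code (up P x))
    = code (up Q (f x))"
proof -
  have po: "partial_order P" "partial_order Q" and sm: "small (carrier P)"
    using P Q by simp_all
  interpret P: partial_order P by (rule po)
  interpret Q: partial_order Q by (rule po)
  have f': "f y \<in> carrier Q" "x \<sqsubseteq>\<^bsub>P\<^esub> y \<Longrightarrow> f x \<sqsubseteq>\<^bsub>Q\<^esub> f y" if "y \<in> carrier P" for y
    using f x that by (auto simp: Pos_Hom_iff[OF po])
  have "(\<Union>y\<in>up P x. up Q (f y)) = up Q (f x)"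
  proof
    show "(\<Union>y\<in>up P x. up Q (f y)) \<subseteq> up Q (f x)"
      using Q.le_trans[OF f'(2) _ f'(1)[OF x] f'(1)] by (auto simp: principal_upper_set_def)
    show "up Q (f x) \<subseteq> (\<Union>y\<in>up P x. up Q (f y))"
      using x by (auto simp: principal_upper_set_def)
  qed
  moreover have "inv_into (upsets P) code (code (up P x)) = up P x"
    using order_isomorphism.g_f[OF order_isomorphism_code[OF sm], of "up P x"]
      up_in_upsets[OF po(1) x] by simp
  ultimately show ?thesis
    unfolding left_adjoint_eq[OF is_left_adjoint_B_Pos_arr[OF P Q f]]
    using up_in_upsets[OF po(1) x] by (simp add: carrier_B_Pos_obj)
qed

lemma B_Pos_arr_in_Hom:
  assumes P: "P \<in> Obj (Pos small)" and Q: "Q \<in> Obj (Pos small)" and f: "f \<in> Hom (Pos small) P Q"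
  shows "B_Pos_arr code P Q f \<in> Hom (AlexLoc small) (B_Pos_obj code P) (B_Pos_obj code Q)"
proof -
  have po: "partial_order P" "partial_order Q" and sm: "small (carrier P)" "small (carrier Q)"
    using P Q by simp_all
  note adj = is_left_adjoint_B_Pos_arr[OF P Q f]
  have "complete_map (B_Pos_obj code P) (B_Pos_obj code Q) (B_Pos_arr code P Q f)"
  proof (rule complete_mapI)
    show "is_left_adjoint (B_Pos_obj code P) (B_Pos_obj code Q) (B_Pos_arr code P Q f)
        (left_adjoint (B_Pos_obj code P) (B_Pos_obj code Q) (B_Pos_arr code P Q f))"
      unfolding left_adjoint_eq[OF adj] using adj by (auto simp: is_left_adjoint_iff)
    fix s assume "supercompact (B_Pos_obj code P) s"
    then obtain x where x: "x \<in> carrier P" "s = code (up P x)"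
      using Collect_supercompact_B_Pos_obj[OF po(1) sm(1)] by blast
    moreover have "f x \<in> carrier Q" using f x by (auto simp: Pos_Hom_iff[OF po])
    ultimately show "supercompact (B_Pos_obj code Q)
        (left_adjoint (B_Pos_obj code P) (B_Pos_obj code Q) (B_Pos_arr code P Q f) s)"
      using Collect_supercompact_B_Pos_obj[OF po(2) sm(2)] left_adjoint_B_Pos_arr[OF P Q f x(1)]
      by auto
  qed (use po sm supercompactly_generated_B_Pos_obj frame_B_Pos_obj in auto)
  moreover have "B_Pos_arr code P Q f \<in> carrier (B_Pos_obj code Q) \<rightarrow>\<^sub>E carrier (B_Pos_obj code P)"
    using adj by (simp add: is_left_adjoint_iff PiE_def) (simp add: B_Pos_arr_def)
  ultimately show ?thesis by simp
qed

lemma cat_functor_B_Pos: "cat_functor (Pos small) (AlexLoc small) (B_Pos code)"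
proof (intro cat_functor.intro category_Pos category_AlexLoc cat_functor_axioms.intro)
  fix P assume P: "P \<in> Obj (Pos small)"
  show "FObj (B_Pos code) P \<in> Obj (AlexLoc small)"
    using B_Pos_obj_in_AlexLoc[OF P] by (simp only: B_Pos_def functor_data.simps)
  have sm: "small (carrier P)" using P by simp
  have "B_Pos_arr code P P (\<lambda>x\<in>carrier P. x) = (\<lambda>u\<in>carrier (B_Pos_obj code P). u)"
  proof (rule extensionalityI[of _ "carrier (B_Pos_obj code P)"])
    fix u assume "u \<in> carrier (B_Pos_obj code P)"
    then obtain S where S: "S \<in> upsets P" "u = code S" by (auto simp: carrier_B_Pos_obj)
    have "{x \<in> carrier P. (\<lambda>x\<in>carrier P. x) x \<in> S} = S" using S(1) by (auto simp: upper_sets_def)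
    then show "B_Pos_arr code P P (\<lambda>x\<in>carrier P. x) u = (\<lambda>u\<in>carrier (B_Pos_obj code P). u) u"
      using B_Pos_arr_code[OF sm S(1), of P "\<lambda>x\<in>carrier P. x"] S by (simp add: carrier_B_Pos_obj)
  qed (simp_all add: B_Pos_arr_def)
  then show "FArr (B_Pos code) P P (Idn (Pos small) P) = Idn (AlexLoc small) (FObj (B_Pos code) P)"
    by (simp add: B_Pos_def)
next
  fix P Q f assume "P \<in> Obj (Pos small)" "Q \<in> Obj (Pos small)" "f \<in> Hom (Pos small) P Q"
  then show "FArr (B_Pos code) P Q f
      \<in> Hom (AlexLoc small) (FObj (B_Pos code) P) (FObj (B_Pos code) Q)"
    using B_Pos_arr_in_Hom[of P Q f] by (simp only: B_Pos_def functor_data.simps)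
next
  fix P Q R f g
  assume P: "P \<in> Obj (Pos small)" and Q: "Q \<in> Obj (Pos small)" and R: "R \<in> Obj (Pos small)"
    and f: "f \<in> Hom (Pos small) P Q" and g: "g \<in> Hom (Pos small) Q R"
  have po: "partial_order P" "partial_order Q" "partial_order R"
    and sm: "small (carrier Q)" "small (carrier R)" using P Q R by simp_all
  have "B_Pos_arr code P R (compose (carrier P) g f)
    = compose (carrier (B_Pos_obj code R)) (B_Pos_arr code P Q f) (B_Pos_arr code Q R g)"
  proof (rule extensionalityI[of _ "carrier (B_Pos_obj code R)"])
    fix u assume u: "u \<in> carrier (B_Pos_obj code R)"
    then obtain S where S: "S \<in> upsets R" "u = code S" by (auto simp: carrier_B_Pos_obj)
    have "{x \<in> carrier P. f x \<in> {y \<in> carrier Q. g y \<in> S}}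
        = {x \<in> carrier P. compose (carrier P) g f x \<in> S}"
      using f by (auto simp: Pos_Hom_iff[OF po(1,2)] compose_def)
    then show "B_Pos_arr code P R (compose (carrier P) g f) u
      = compose (carrier (B_Pos_obj code R)) (B_Pos_arr code P Q f) (B_Pos_arr code Q R g) u"
      using u S B_Pos_arr_code[OF sm(2) S(1)]
        B_Pos_arr_code[OF sm(1) preimage_in_upsets[OF po(2,3) g S(1)]]
      by (simp add: compose_eq)
  qed (simp_all add: B_Pos_arr_def compose_def)
  then show "FArr (B_Pos code) P R (Cmp (Pos small) P Q R g f)
    = Cmp (AlexLoc small) (FObj (B_Pos code) P) (FObj (B_Pos code) Q) (FObj (B_Pos code) R)
        (FArr (B_Pos code) Q R g) (FArr (B_Pos code) P Q f)"
    by (simp add: B_Pos_def)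
qed

end

section \<open>The poset of supercompact elements\<close>

lemma I_B_simps [simp]:
  "FObj I_B L = inv_gorder (supercompact_poset L)"
  "FArr I_B L L' g = restrict (left_adjoint L L' g) (Collect (supercompact L))"
  by (simp_all add: I_B_def)

lemma supercompact_poset_simps [simp]:
  "carrier (supercompact_poset L) = Collect (supercompact L)"
  "eq (supercompact_poset L) = (=)"
  "le (supercompact_poset L) x y \<longleftrightarrow> supercompact L x \<and> supercompact L y \<and> x \<sqsubseteq>\<^bsub>L\<^esub> y"
  by (simp_all add: supercompact_poset_def)

lemma partial_order_supercompact_poset:
  assumes "partial_order L"
  shows "partial_order (supercompact_poset L)"
proof -
  interpret partial_order L by fact
  show ?thesis
    by (rule gorder_partial_orderI)
      (auto dest: supercompact_closed
        intro: le_trans[OF _ _ supercompact_closed supercompact_closed supercompact_closed])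
qed

lemma (in universe) I_B_in_Pos:
  assumes "L \<in> Obj (AlexLoc small)"
  shows "inv_gorder (supercompact_poset L) \<in> Obj (Pos small)"
proof -
  have L: "alexandrov_locale small L" using assms by simp
  then have "partial_order L" by (simp add: alexandrov_locale_def frame_partial_order)
  then show ?thesis
    using partial_order.dual_order[OF partial_order_supercompact_poset] small_supercompact[OF L]
    by (simp add: order_on_carrier_def)
qed

lemma (in universe) cat_functor_I_B: "cat_functor (AlexLoc small) (Pos small) I_B"
proof (intro cat_functor.intro category_Pos category_AlexLoc cat_functor_axioms.intro)
  show "FObj I_B L \<in> Obj (Pos small)" if "L \<in> Obj (AlexLoc small)" for L :: "'u gorder"
    using I_B_in_Pos[OF that] by (simp only: I_B_simps)
next
  fix L L' :: "'u gorder" and g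
  assume L: "L \<in> Obj (AlexLoc small)" "L' \<in> Obj (AlexLoc small)"
    and g: "g \<in> Hom (AlexLoc small) L L'"
  then have cm: "complete_map L L' g" by simp
  interpret G: galois_connection
    "\<lparr>orderA = L, orderB = L', lower = left_adjoint L L' g, upper = g\<rparr>"
    using complete_map_left_adjoint(1)[OF cm] unfolding is_left_adjoint_def .
  have mono: "left_adjoint L L' g x \<sqsubseteq>\<^bsub>L'\<^esub> left_adjoint L L' g y"
    if "supercompact L x" "supercompact L y" "x \<sqsubseteq>\<^bsub>L\<^esub> y" for x y
    using use_iso2[OF G.lower_iso] that supercompact_closed[of L] by simp
  have "partial_order (inv_gorder (supercompact_poset L))"
    "partial_order (inv_gorder (supercompact_poset L'))"
    using I_B_in_Pos[OF L(1)] I_B_in_Pos[OF L(2)] by simp_all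
  then show "FArr I_B L L' g \<in> Hom (Pos small) (FObj I_B L) (FObj I_B L')"
    using complete_map_left_adjoint(2)[OF cm] mono
    by (auto simp: Pos_Hom_iff)
next
  fix L :: "'u gorder" assume "L \<in> Obj (AlexLoc small)"
  then have "partial_order L" by (simp add: alexandrov_locale_def frame_partial_order)
  then have "left_adjoint L L (\<lambda>x\<in>carrier L. x) = (\<lambda>x\<in>carrier L. x)"
    by (rule left_adjoint_eq[OF is_left_adjoint_id])
  then show "FArr I_B L L (Idn (AlexLoc small) L) = Idn (Pos small) (FObj I_B L)"
    by (auto simp: restrict_def supercompact_closed)
next
  fix L L' L'' :: "'u gorder" and g h
  assume "g \<in> Hom (AlexLoc small) L L'" "h \<in> Hom (AlexLoc small) L' L''"
  then have cm: "complete_map L L' g" "complete_map L' L'' h" by simp_all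
  have "left_adjoint L L'' (compose (carrier L'') g h)
      = (\<lambda>x\<in>carrier L. left_adjoint L' L'' h (left_adjoint L L' g x))"
    by (rule left_adjoint_eq[OF is_left_adjoint_compose[OF
            complete_map_left_adjoint(1)[OF cm(1)] complete_map_left_adjoint(1)[OF cm(2)]]])
  then show "FArr I_B L L'' (Cmp (AlexLoc small) L L' L'' h g)
    = Cmp (Pos small) (FObj I_B L) (FObj I_B L') (FObj I_B L'') (FArr I_B L' L'' h) (FArr I_B L L' g)"
    using complete_map_left_adjoint(2)[OF cm(1)]
    by (auto simp: restrict_def compose_def supercompact_closed)
qed

definition supercompacts_below :: "'a gorder \<Rightarrow> 'a \<Rightarrow> 'a set" where
  "supercompacts_below L a = {s. supercompact L s \<and> s \<sqsubseteq>\<^bsub>L\<^esub> a}"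

lemma supercompacts_below_in_upsets:
  assumes "partial_order L" "a \<in> carrier L"
  shows "supercompacts_below L a \<in> upsets (inv_gorder (supercompact_poset L))"
proof -
  interpret partial_order L by fact
  show ?thesis
    using assms(2) by (auto simp: upper_sets_def supercompacts_below_def)
      (blast intro: le_trans supercompact_closed)
qed

section \<open>The unit and the counit\<close>

context universe
begin

text \<open>
  Principal upper sets are ordered by reverse inclusion here, which undoes the order
  reversal in \<open>\<up>y \<subseteq> \<up>x \<longleftrightarrow> x \<le> y\<close>.
\<close>

lemma order_isomorphism_unit:
  assumes P: "P \<in> Obj (Pos small)"
  shows "\<exists>g. order_isomorphism P (inv_gorder (supercompact_poset (B_Pos_obj code P)))
    (\<lambda>x. code (up P x)) g"
proof (rule exI, rule order_isomorphism_of_surj_embedding)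
  have po: "partial_order P" and sm: "small (carrier P)" using P by simp_all
  note K = Collect_supercompact_B_Pos_obj[OF po sm]
  interpret P: partial_order P by (rule po)
  show "partial_order P" by (rule po)
  show "partial_order (inv_gorder (supercompact_poset (B_Pos_obj code P)))"
    using I_B_in_Pos[OF B_Pos_obj_in_AlexLoc[OF P]] by simp
  show "(\<lambda>x. code (up P x)) ` carrier P
      = carrier (inv_gorder (supercompact_poset (B_Pos_obj code P)))"
    using K by simp
  fix x y assume x: "x \<in> carrier P" and y: "y \<in> carrier P"
  have "supercompact (B_Pos_obj code P) (code (up P x))"
    "supercompact (B_Pos_obj code P) (code (up P y))" using K x y by blast+
  then have "code (up P x) \<sqsubseteq>\<^bsub>inv_gorder (supercompact_poset (B_Pos_obj code P))\<^esub> code (up P y)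
      \<longleftrightarrow> up P y \<subseteq> up P x"
    using le_B_Pos_obj_iff[OF sm] up_in_upsets[OF po] x y by simp
  also have "\<dots> \<longleftrightarrow> y \<in> up P x" using up_subset_iff[OF po y up_in_upsets[OF po x]] .
  also have "\<dots> \<longleftrightarrow> x \<sqsubseteq>\<^bsub>P\<^esub> y" using y by (simp add: principal_upper_set_def)
  finally show "code (up P x) \<sqsubseteq>\<^bsub>inv_gorder (supercompact_poset (B_Pos_obj code P))\<^esub> code (up P y)
      \<longleftrightarrow> x \<sqsubseteq>\<^bsub>P\<^esub> y" .
qed

text \<open>
  The map is an order embedding since \<open>L\<close> is generated by supercompact elements. It is surjective
  since a lower set \<open>S\<close> of supercompact elements consists, by join-primeness, of all supercompact
  elements below \<open>\<Squnion>S\<close>.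
\<close>

lemma order_isomorphism_counit:
  assumes L: "L \<in> Obj (AlexLoc small)"
  shows "\<exists>g. order_isomorphism L (B_Pos_obj code (inv_gorder (supercompact_poset L)))
    (\<lambda>a. code (supercompacts_below L a)) g"
    (is "\<exists>g. order_isomorphism L (B_Pos_obj code ?I) _ g")
proof (rule exI, rule order_isomorphism_of_surj_embedding)
  have gen: "supercompactly_generated L" using L supercompactly_generated_alexandrov by auto
  then have fr: "frame L" by (simp add: supercompactly_generated_def)
  interpret frame L by (rule fr)
  have sm: "small (carrier ?I)" using I_B_in_Pos[OF L] by simp
  note below = supercompacts_below_in_upsets[OF partial_order_axioms]
  show "partial_order L" by (rule partial_order_axioms)
  show "partial_order (B_Pos_obj code ?I)" by (rule partial_order_B_Pos_obj[OF sm])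
  show "code (supercompacts_below L a) \<sqsubseteq>\<^bsub>B_Pos_obj code ?I\<^esub> code (supercompacts_below L b)
      \<longleftrightarrow> a \<sqsubseteq>\<^bsub>L\<^esub> b" if a: "a \<in> carrier L" and b: "b \<in> carrier L" for a b
  proof -
    have "supercompacts_below L a \<subseteq> supercompacts_below L b \<longleftrightarrow> a \<sqsubseteq>\<^bsub>L\<^esub> b"
    proof
      assume "supercompacts_below L a \<subseteq> supercompacts_below L b"
      then show "a \<sqsubseteq>\<^bsub>L\<^esub> b"
        using gen a b unfolding supercompacts_below_def supercompactly_generated_def by blast
    next
      assume "a \<sqsubseteq>\<^bsub>L\<^esub> b"
      then show "supercompacts_below L a \<subseteq> supercompacts_below L b"
        using a b by (auto simp: supercompacts_below_def)
          (blast intro: le_trans supercompact_closed)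
    qed
    then show ?thesis using le_B_Pos_obj_iff[OF sm below[OF a] below[OF b]] by simp
  qed
  show "(\<lambda>a. code (supercompacts_below L a)) ` carrier L = carrier (B_Pos_obj code ?I)"
    unfolding carrier_B_Pos_obj
  proof (intro subset_antisym subsetI)
    fix u assume "u \<in> code ` upsets ?I"
    then obtain S where S: "S \<in> upsets ?I" "u = code S" by blast
    have SL: "S \<subseteq> carrier L"
      using S(1) by (auto simp: upper_sets_def intro: supercompact_closed)
    have "supercompacts_below L (\<Squnion>\<^bsub>L\<^esub> S) = S"
    proof (rule Set.set_eqI)
      fix s
      have "s \<in> supercompacts_below L (\<Squnion>\<^bsub>L\<^esub> S)
          \<longleftrightarrow> supercompact L s \<and> (\<exists>a\<in>S. s \<sqsubseteq>\<^bsub>L\<^esub> a)"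
        using supercompact_le_sup_iff[OF fr _ SL] by (auto simp: supercompacts_below_def)
      also have "\<dots> \<longleftrightarrow> s \<in> S"
      proof
        assume "s \<in> S"
        then have "supercompact L s" "s \<sqsubseteq>\<^bsub>L\<^esub> s" using S(1) SL by (auto simp: upper_sets_def)
        then show "supercompact L s \<and> (\<exists>a\<in>S. s \<sqsubseteq>\<^bsub>L\<^esub> a)" using \<open>s \<in> S\<close> by blast
      qed (use S(1) in \<open>auto simp: upper_sets_def\<close>)
      finally show "s \<in> supercompacts_below L (\<Squnion>\<^bsub>L\<^esub> S) \<longleftrightarrow> s \<in> S" .
    qed
    then have "u = code (supercompacts_below L (\<Squnion>\<^bsub>L\<^esub> S))" using S(2) by simp
    then show "u \<in> (\<lambda>a. code (supercompacts_below L a)) ` carrier L"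
      using sup_closed[OF SL] by (rule image_eqI)
  qed (use below in auto)
qed

lemma natural_iso_unit:
  "natural_iso (Pos small) (Pos small) id_functor (comp_functor I_B (B_Pos code))
    (\<lambda>P. \<lambda>x\<in>carrier P. code (up P x))"
proof (intro natural_iso.intro natural_iso_axioms.intro)
  show "cat_functor (Pos small) (Pos small) id_functor" by (rule cat_functor_id[OF category_Pos])
  show "cat_functor (Pos small) (Pos small) (comp_functor I_B (B_Pos code))"
    by (rule cat_functor_comp[OF cat_functor_B_Pos cat_functor_I_B])
next
  fix P assume P: "P \<in> Obj (Pos small)"
  obtain g where "order_isomorphism P (inv_gorder (supercompact_poset (B_Pos_obj code P)))
      (\<lambda>x. code (up P x)) g"
    using order_isomorphism_unit[OF P] by blast
  from iso_arrow_Pos[OF this P I_B_in_Pos[OF B_Pos_obj_in_AlexLoc[OF P]]]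
  show "iso_arrow (Pos small) (FObj id_functor P) (FObj (comp_functor I_B (B_Pos code)) P)
      (\<lambda>x\<in>carrier P. code (up P x))"
    by (simp add: id_functor_def comp_functor_def B_Pos_def)
next
  fix P Q f assume P: "P \<in> Obj (Pos small)" and Q: "Q \<in> Obj (Pos small)"
    and f: "f \<in> Hom (Pos small) P Q"
  have po: "partial_order P" "partial_order Q" and sm: "small (carrier P)"
    using P Q by simp_all
  have "compose (carrier P) (\<lambda>x\<in>carrier Q. code (up Q x)) f
      = compose (carrier P) (restrict
          (left_adjoint (B_Pos_obj code P) (B_Pos_obj code Q) (B_Pos_arr code P Q f))
          (Collect (supercompact (B_Pos_obj code P)))) (\<lambda>x\<in>carrier P. code (up P x))"
  proof (rule extensionalityI[of _ "carrier P"])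
    fix x assume x: "x \<in> carrier P"
    then have "supercompact (B_Pos_obj code P) (code (up P x))" "f x \<in> carrier Q"
      using Collect_supercompact_B_Pos_obj[OF po(1) sm] f by (auto simp: Pos_Hom_iff[OF po])
    then show "compose (carrier P) (\<lambda>x\<in>carrier Q. code (up Q x)) f x
      = compose (carrier P) (restrict
          (left_adjoint (B_Pos_obj code P) (B_Pos_obj code Q) (B_Pos_arr code P Q f))
          (Collect (supercompact (B_Pos_obj code P)))) (\<lambda>x\<in>carrier P. code (up P x)) x"
      using x left_adjoint_B_Pos_arr[OF P Q f x] by (simp add: compose_eq)
  qed simp_all
  then show "Cmp (Pos small) (FObj id_functor P) (FObj id_functor Q)
      (FObj (comp_functor I_B (B_Pos code)) Q) (\<lambda>x\<in>carrier Q. code (up Q x))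
      (FArr id_functor P Q f)
    = Cmp (Pos small) (FObj id_functor P) (FObj (comp_functor I_B (B_Pos code)) P)
      (FObj (comp_functor I_B (B_Pos code)) Q) (FArr (comp_functor I_B (B_Pos code)) P Q f)
      (\<lambda>x\<in>carrier P. code (up P x))"
    by (simp add: id_functor_def comp_functor_def B_Pos_def)
qed

text \<open>
  A component is given by the frame homomorphism from the frame of \<open>L\<close> to the upper sets, which
  is opposite to the direction of the locale morphism; therefore \<open>iso_arrow_AlexLoc\<close> is applied
  to the inverse of the isomorphism above.
\<close>

lemma natural_iso_counit:
  "natural_iso (AlexLoc small) (AlexLoc small) (comp_functor (B_Pos code) I_B) id_functor
    (\<lambda>L. \<lambda>a\<in>carrier L. code (supercompacts_below L a))"
proof (intro natural_iso.intro natural_iso_axioms.intro)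
  show "cat_functor (AlexLoc small) (AlexLoc small) id_functor"
    by (rule cat_functor_id[OF category_AlexLoc])
  show "cat_functor (AlexLoc small) (AlexLoc small) (comp_functor (B_Pos code) I_B)"
    by (rule cat_functor_comp[OF cat_functor_I_B cat_functor_B_Pos])
next
  fix L assume L: "L \<in> Obj (AlexLoc small)"
  obtain g where "order_isomorphism L (B_Pos_obj code (inv_gorder (supercompact_poset L)))
      (\<lambda>a. code (supercompacts_below L a)) g"
    using order_isomorphism_counit[OF L] by blast
  from iso_arrow_AlexLoc[OF order_isomorphism.inverse[OF this]
      B_Pos_obj_in_AlexLoc[OF I_B_in_Pos[OF L]] L]
  show "iso_arrow (AlexLoc small) (FObj (comp_functor (B_Pos code) I_B) L) (FObj id_functor L)
      (\<lambda>a\<in>carrier L. code (supercompacts_below L a))"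
    by (simp add: id_functor_def comp_functor_def B_Pos_def)
next
  fix L L' :: "'u gorder" and g
  assume L: "L \<in> Obj (AlexLoc small)" and L': "L' \<in> Obj (AlexLoc small)"
    and g: "g \<in> Hom (AlexLoc small) L L'"
  let ?I = "inv_gorder (supercompact_poset L)" and ?I' = "inv_gorder (supercompact_poset L')"
  let ?l = "restrict (left_adjoint L L' g) (Collect (supercompact L))"
  have cm: "complete_map L L' g" and gE: "g \<in> carrier L' \<rightarrow>\<^sub>E carrier L" using g by simp_all
  have sm: "small (carrier ?I')" using I_B_in_Pos[OF L'] by simp
  have po: "partial_order L'" using L' by (simp add: alexandrov_locale_def frame_partial_order)
  have "compose (carrier L') (B_Pos_arr code ?I ?I' ?l)
        (\<lambda>a\<in>carrier L'. code (supercompacts_below L' a))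
      = compose (carrier L') (\<lambda>a\<in>carrier L. code (supercompacts_below L a)) g"
  proof (rule extensionalityI[of _ "carrier L'"])
    fix a assume a: "a \<in> carrier L'"
    \<comment> \<open>This is the adjunction \<open>g\<^sub>! s \<le> a \<longleftrightarrow> s \<le> g\<^sup>* a\<close>, restricted to supercompact \<open>s\<close>.\<close>
    have "{s \<in> carrier ?I. ?l s \<in> supercompacts_below L' a} = supercompacts_below L (g a)"
      using complete_map_left_adjoint[OF cm] a supercompact_closed[of L]
      by (auto simp: supercompacts_below_def is_left_adjoint_iff)
    then have "B_Pos_arr code ?I ?I' ?l (code (supercompacts_below L' a))
        = code (supercompacts_below L (g a))"
      using B_Pos_arr_code[OF sm supercompacts_below_in_upsets[OF po a]] by simp
    then show "compose (carrier L') (B_Pos_arr code ?I ?I' ?l)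
        (\<lambda>a\<in>carrier L'. code (supercompacts_below L' a)) a
      = compose (carrier L') (\<lambda>a\<in>carrier L. code (supercompacts_below L a)) g a"
      using a gE by (auto simp: compose_eq)
  qed simp_all
  then show "Cmp (AlexLoc small) (FObj (comp_functor (B_Pos code) I_B) L)
      (FObj (comp_functor (B_Pos code) I_B) L') (FObj id_functor L')
      (\<lambda>a\<in>carrier L'. code (supercompacts_below L' a))
      (FArr (comp_functor (B_Pos code) I_B) L L' g)
    = Cmp (AlexLoc small) (FObj (comp_functor (B_Pos code) I_B) L) (FObj id_functor L)
      (FObj id_functor L') (FArr id_functor L L' g)
      (\<lambda>a\<in>carrier L. code (supercompacts_below L a))"
    by (simp add: id_functor_def comp_functor_def B_Pos_def)
qed

end

theorem theorem4p2:
  fixes small :: "'u set \<Rightarrow> bool" and code :: "'u set \<Rightarrow> 'u"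
  assumes "universe small code"
  shows "equivalence_via (Pos small) (AlexLoc small) (B_Pos code) I_B"
  unfolding equivalence_via_def
  using universe.cat_functor_B_Pos[OF assms] universe.cat_functor_I_B[OF assms]
    universe.natural_iso_unit[OF assms] universe.natural_iso_counit[OF assms] by blast

end
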